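(* Let $p$ and $q$ be positive integers with $p\ge q$. If $G$ is a planar graph with maximum degree $\Delta\ge 32$ that contains neither $4$-cycles nor $5$-cycles, then $\lambda_{p,q}(G)\le (2q-1)\Delta+6p-2q-2$. In particular, $\lambda_{2,1}(G)\le \Delta+8$.
   Context: Graphs are finite and simple. "Contains no $k$-cycle" means there is no cycle of length $k$ as a (not necessarily induced) subgraph. An $L(p,q)$-labeling of a graph $G$ is an assignment $f$ of nonnegative integers to the vertices of $G$ such that all adjacent vertices $u$ and $v$ satisfy $|f(u)-f(v)|\ge p$ and all vertices $u$ and $v$ at distance two satisfy $|f(u)-f(v)|\ge q$. The $L(p,q)$-labeling number $\lambda_{p,q}(G)$ is the minimum, over all $L(p,q)$-labelings of $G$, of the largest label used. *)

theory Defs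
  imports "HOL-Analysis.Analysis" "HOL-Library.Extended_Nat"
begin

text \<open>A graph is given by a vertex set \<open>V\<close> and a set \<open>E\<close> of two-element subsets of \<open>V\<close>.\<close>

definition simple_graph :: "'a set \<Rightarrow> 'a set set \<Rightarrow> bool" where
  "simple_graph V E \<longleftrightarrow> finite V \<and> (\<forall>e\<in>E. e \<subseteq> V \<and> card e = 2)"

definition vertex_degree :: "'a set set \<Rightarrow> 'a \<Rightarrow> nat" where
  "vertex_degree E v = card {e \<in> E. v \<in> e}"

definition max_degree :: "'a set \<Rightarrow> 'a set set \<Rightarrow> nat" where
  "max_degree V E = Max (vertex_degree E ` V)"

definition contains_cycle :: "'a set set \<Rightarrow> nat \<Rightarrow> bool" where
  "contains_cycle E k \<longleftrightarrow> 3 \<le> k \<and>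
     (\<exists>c. length c = k \<and> distinct c \<and> (\<forall>i<k. {c ! i, c ! (Suc i mod k)} \<in> E))"

definition walk :: "'a set \<Rightarrow> 'a set set \<Rightarrow> 'a list \<Rightarrow> bool" where
  "walk V E w \<longleftrightarrow> w \<noteq> [] \<and> set w \<subseteq> V \<and> (\<forall>i. Suc i < length w \<longrightarrow> {w ! i, w ! Suc i} \<in> E)"

text \<open>The distance is \<open>\<infinity>\<close> for vertices in different components.\<close>

definition graph_dist :: "'a set \<Rightarrow> 'a set set \<Rightarrow> 'a \<Rightarrow> 'a \<Rightarrow> enat" where
  "graph_dist V E u v =
     (INF w \<in> {w. walk V E w \<and> hd w = u \<and> last w = v}. enat (length w - 1))"

text \<open>
  A planar drawing: vertices are distinct points of the plane, edges are simple arcs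
  joining the points of their end vertices and passing through no other vertex, and distinct
  edges meet only in points of common end vertices.
\<close>

definition planar_drawing ::
    "'a set \<Rightarrow> 'a set set \<Rightarrow> ('a \<Rightarrow> complex) \<Rightarrow> ('a set \<Rightarrow> real \<Rightarrow> complex) \<Rightarrow> bool" where
  "planar_drawing V E pos \<gamma> \<longleftrightarrow>
     inj_on pos V \<and>
     (\<forall>e\<in>E. arc (\<gamma> e) \<and> {pathstart (\<gamma> e), pathfinish (\<gamma> e)} = pos ` e \<and>
             path_image (\<gamma> e) \<inter> pos ` V = pos ` e) \<and>
     (\<forall>e\<in>E. \<forall>e'\<in>E. e \<noteq> e' \<longrightarrow> path_image (\<gamma> e) \<inter> path_image (\<gamma> e') = pos ` (e \<inter> e'))"

definition planar :: "'a set \<Rightarrow> 'a set set \<Rightarrow> bool" where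
  "planar V E \<longleftrightarrow> (\<exists>pos \<gamma>. planar_drawing V E pos \<gamma>)"

definition L_labeling ::
    "'a set \<Rightarrow> 'a set set \<Rightarrow> nat \<Rightarrow> nat \<Rightarrow> ('a \<Rightarrow> nat) \<Rightarrow> bool" where
  "L_labeling V E p q f \<longleftrightarrow>
     (\<forall>u\<in>V. \<forall>v\<in>V.
        ({u, v} \<in> E \<longrightarrow> \<bar>int (f u) - int (f v)\<bar> \<ge> int p) \<and>
        (graph_dist V E u v = 2 \<longrightarrow> \<bar>int (f u) - int (f v)\<bar> \<ge> int q))"

text \<open>
  Every finite graph has an \<open>L(p,q)\<close>-labeling, so for nonempty \<open>V\<close> the least element exists;
  for empty \<open>V\<close> the value carries no meaning.
\<close>

definition L_number :: "'a set \<Rightarrow> 'a set set \<Rightarrow> nat \<Rightarrow> nat \<Rightarrow> nat" where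
  "L_number V E p q = (LEAST k. \<exists>f. L_labeling V E p q f \<and> Max (f ` V) = k)"

end

theory Submission
  imports Defs
begin

text \<open>
  Label the vertices greedily in an order in which every vertex has at most three earlier
  neighbours and at most \<open>\<Delta> + 2\<close> earlier vertices within distance two. Removing vertices from the end of
  the order, such an order exists unless one gets stuck in a nonempty set \<open>T\<close>; then every vertex
  outside \<open>T\<close> has at most three neighbours in \<open>T\<close>.
  A planar graph with \<open>n > 0\<close> vertices, \<open>m\<close> edges, \<open>\<tau>\<close> triangles and no 4- or 5-cycles satisfies
  \<open>4 m + 6 \<le> 6 n + 3 \<tau>\<close>, as all face lengths other than 3 are at least 6. In terms of the charges
  \<open>2 d(v) - 6\<close> of the vertices and \<open>- 3\<close> of the triangles this says that the total charge is at most
  \<open>- 6\<close>. If \<open>T\<close> were stuck, a vertex of degree at most 3 in \<open>T\<close> would have a large neighbour or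
  many vertices of \<open>T\<close> reachable through outside vertices; large vertices give \<open>2 - 6 / d\<close> along
  every edge, outside vertices have charge to spare as well, and the total charge is nonnegative.

  The edge bound needs no face counting: for a cycle \<open>C\<close>, the closed inner domain of \<open>C\<close> satisfies
  \<open>4 m + |C| + 6 \<le> 6 n + 3 \<tau>\<close>, by induction along the splitting of \<open>C\<close> by an inner path.
\<close>

section \<open>Paths, cycles and triangles\<close>

text \<open>The shrinking of \<open>T\<close> is the main obstacle: two vertices of \<open>T\<close>
  joined only through a removed vertex still constrain each other, so removed vertices cannot be
  forgotten. The edge bound is therefore applied to \<open>T\<close> together with those removed
  vertices that link some pair of \<open>T\<close>. Such a vertex, with a neighbours in
  \<open>T\<close> and e edges among these, has 4 a - 6 - 3 e to spare. The scarcest case is a = 3,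
  e = 1, with 3 units for 4 ordered pairs; this is the origin of the rate 3 / 4 per linked vertex.
  The absence of 4-cycles acts twice: it bounds face lengths, and it makes triangles edge-disjoint.
  Hence a vertex of degree at most 3 lies in at most one triangle and can pass its charge on to it.
  The bound on the labels is 3 (2 p - 1) + (\<Delta> - 1) (2 q - 1): three earlier neighbours and
  \<Delta> - 1 further close vertices, each forbidding an interval of labels.\<close>

fun path_edges :: "'a list \<Rightarrow> 'a set set" where
  "path_edges (x # y # zs) = insert {x, y} (path_edges (y # zs))"
| "path_edges _ = {}"

lemma path_edges_append:
  "path_edges (xs @ y # ys) = path_edges (xs @ [y]) \<union> path_edges (y # ys)"
proof (induction xs)
  case (Cons x xs)
  then show ?case by (cases xs) auto
qed simp

lemma path_edges_rev: "path_edges (rev w) = path_edges w"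
proof (induction w rule: path_edges.induct)
  case (1 x y zs)
  have "path_edges (rev (x # y # zs)) = path_edges (rev zs @ y # [x])" by simp
  also have "\<dots> = path_edges (rev (y # zs)) \<union> {{x, y}}"
    by (subst path_edges_append) (auto simp: insert_commute)
  finally show ?case using 1 by auto
qed auto

lemma finite_path_edges [simp]: "finite (path_edges w)"
  by (induction w rule: path_edges.induct) auto

lemma path_edges_subset: "e \<in> path_edges w \<Longrightarrow> e \<subseteq> set w"
  by (induction w rule: path_edges.induct) auto

lemma Union_path_edges: "2 \<le> length w \<Longrightarrow> \<Union> (path_edges w) = set w"
proof (induction w rule: path_edges.induct)
  case (1 x y zs)
  then show ?case by (cases zs) auto
qed auto

lemma path_edges_nth: "Suc i < length w \<Longrightarrow> {w ! i, w ! Suc i} \<in> path_edges w"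
proof (induction w arbitrary: i rule: path_edges.induct)
  case (1 x y zs)
  then show ?case by (cases i) auto
qed auto

lemma card_path_edges: "distinct w \<Longrightarrow> w \<noteq> [] \<Longrightarrow> Suc (card (path_edges w)) = length w"
proof (induction w rule: path_edges.induct)
  case (1 x y zs)
  have "{x, y} \<notin> path_edges (y # zs)"
    using 1 path_edges_subset[of "{x, y}" "y # zs"] by auto
  then show ?case using 1 by simp
qed auto

lemma path_edges_hd_unique:
  assumes "distinct (x # w)" "e \<in> path_edges (x # w)" "x \<in> e"
  shows "w \<noteq> [] \<and> e = {x, hd w}"
  using assms path_edges_subset[of e w] by (cases w) auto

lemma path_edges_no_triangle:
  assumes "distinct w" "card t = 3" "\<And>e. e \<subseteq> t \<Longrightarrow> card e = 2 \<Longrightarrow> e \<in> path_edges w"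
  shows False
  using assms
proof (induction w)
  case Nil
  obtain x y z where "t = {x, y, z}" "x \<noteq> y"
    using Nil(2) by (auto simp: card_3_iff)
  then show ?case using Nil(3)[of "{x, y}"] by auto
next
  case (Cons a w)
  show ?case
  proof (cases "a \<in> t")
    case True
    then have "card (t - {a}) = 2"
      using Cons.prems(2) by simp
    then obtain y z where yz: "t - {a} = {y, z}" "y \<noteq> z"
      by (auto simp: card_2_iff)
    with True have "{a, y} \<subseteq> t" "{a, z} \<subseteq> t" "card {a, y} = 2" "card {a, z} = 2"
      by (auto simp: card_insert_if)
    then have "{a, y} \<in> path_edges (a # w)" "{a, z} \<in> path_edges (a # w)"
      using Cons.prems(3) by auto
    then have "{a, y} = {a, hd w}" "{a, z} = {a, hd w}"
      using path_edges_hd_unique[OF Cons.prems(1)] by blast+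
    then show False using yz by (auto simp: doubleton_eq_iff)
  next
    case False
    have "e \<in> path_edges w" if "e \<subseteq> t" "card e = 2" for e
    proof -
      have "e \<in> path_edges (a # w)" "a \<notin> e" using that False Cons.prems(3) by auto
      then show ?thesis by (cases w) auto
    qed
    then show ?thesis using Cons by auto
  qed
qed

text \<open>Start and direction are forgotten, since the counts involve only the two sets;
  \<open>is_cycle_split\<close> recovers a listing from any two chosen vertices.\<close>

definition is_cycle :: "'a set \<Rightarrow> 'a set set \<Rightarrow> bool" where
  "is_cycle W F \<longleftrightarrow>
     (\<exists>c. distinct c \<and> 3 \<le> length c \<and> W = set c \<and> F = path_edges (c @ [hd c]))"

lemma is_cycleI:
  assumes "distinct (a # xs @ b # ys)" "xs \<noteq> [] \<or> ys \<noteq> []"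
  shows "is_cycle (set (a # xs @ b # ys)) (path_edges (a # xs @ [b]) \<union> path_edges (b # ys @ [a]))"
proof -
  have "path_edges ((a # xs @ b # ys) @ [a])
      = path_edges (a # xs @ [b]) \<union> path_edges (b # ys @ [a])"
    using path_edges_append[of "a # xs" b "ys @ [a]"] by simp
  moreover have "3 \<le> length (a # xs @ b # ys)" using assms(2) by (cases xs; cases ys) auto
  ultimately show ?thesis unfolding is_cycle_def using assms(1)
    by (intro exI[of _ "a # xs @ b # ys"]) auto
qed

text \<open>Rotating the list puts \<open>a\<close> first; cutting at \<open>b\<close> then leaves
  the two arcs.\<close>

lemma is_cycle_split:
  assumes "is_cycle W F" "a \<in> W" "b \<in> W" "a \<noteq> b"
  obtains xs ys where "distinct (a # xs @ b # ys)" "W = set (a # xs @ b # ys)"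
    "F = path_edges (a # xs @ [b]) \<union> path_edges (b # ys @ [a])" "xs \<noteq> [] \<or> ys \<noteq> []"
proof -
  obtain c where c: "distinct c" "3 \<le> length c" "W = set c" "F = path_edges (c @ [hd c])"
    using assms(1) unfolding is_cycle_def by blast
  obtain us vs where uv: "c = us @ a # vs"
    using c(3) assms(2) by (metis split_list)
  have F: "F = path_edges ((a # vs @ us) @ [a])"
  proof (cases us)
    case Nil
    then show ?thesis using c(4) uv by simp
  next
    case (Cons u us')
    have "F = path_edges (us @ a # (vs @ [u]))" using c(4) uv Cons by simp
    also have "\<dots> = path_edges (us @ [a]) \<union> path_edges ((a # vs) @ [u])"
      by (subst path_edges_append) simp
    also have "\<dots> = path_edges ((a # vs) @ u # (us' @ [a]))"
      by (subst path_edges_append[of "a # vs" u "us' @ [a]"]) (use Cons in auto)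
    finally show ?thesis using Cons by simp
  qed
  have "b \<in> set (vs @ us)" using c(3) assms uv by auto
  then obtain xs ys where xy: "vs @ us = xs @ b # ys" by (metis split_list)
  have "F = path_edges (a # xs @ [b]) \<union> path_edges (b # ys @ [a])"
    using path_edges_append[of "a # xs" b "ys @ [a]"] F xy by simp
  moreover have d: "distinct (a # xs @ b # ys)"
    using c(1) uv xy[symmetric] by auto
  moreover have W: "W = set (a # xs @ b # ys)"
    using c(3) uv xy[symmetric] by auto
  moreover have "xs \<noteq> [] \<or> ys \<noteq> []"
  proof (rule ccontr)
    assume "\<not> ?thesis"
    then have "length (vs @ us) = 1" using xy by simp
    then show False using c(2) uv by simp
  qed
  ultimately show ?thesis using that by blast
qed

lemma is_cycle_finite: "is_cycle W F \<Longrightarrow> finite W \<and> finite F"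
  unfolding is_cycle_def by auto

lemma is_cycle_card_ge: "is_cycle W F \<Longrightarrow> 3 \<le> card W"
  unfolding is_cycle_def by (metis distinct_card)

lemma is_cycle_Union: "is_cycle W F \<Longrightarrow> \<Union> F = W"
proof -
  assume "is_cycle W F"
  then obtain c where c: "3 \<le> length c" "W = set c" "F = path_edges (c @ [hd c])"
    unfolding is_cycle_def by blast
  have "hd c \<in> set c" using c(1) by (intro hd_in_set) auto
  then show ?thesis using c Union_path_edges[of "c @ [hd c]"] by auto
qed

lemma is_cycle_card: "is_cycle W F \<Longrightarrow> card F = card W"
proof -
  assume "is_cycle W F"
  then obtain c where c: "distinct c" "3 \<le> length c" "W = set c" "F = path_edges (c @ [hd c])"
    unfolding is_cycle_def by blast
  obtain a d l where c': "c = a # d @ [l]" "d \<noteq> []"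
  proof -
    obtain a c1 where 1: "c = a # c1" using c(2) by (cases c) auto
    then obtain d l where 2: "c1 = d @ [l]" using c(2) by (cases c1 rule: rev_cases) auto
    show ?thesis using that[of a d l] 1 2 c(2) by (cases d) auto
  qed
  have F: "F = insert {l, a} (path_edges c)"
    using c(4) c' path_edges_append[of "a # d" l "[a]"] by auto
  \<comment> \<open>A path has only one edge at its first vertex, and as \<open>d\<close> is
    nonempty that edge does not lead to \<open>l\<close>.\<close>
  have "{l, a} \<notin> path_edges c"
  proof
    assume "{l, a} \<in> path_edges c"
    then have "{l, a} = {a, hd (d @ [l])}"
      using path_edges_hd_unique[of a "d @ [l]" "{l, a}"] c(1) c' by auto
    then have "l = hd d" "hd d \<in> set d" using c(1) c' by (auto simp: doubleton_eq_iff)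
    then show False using c(1) c' by auto
  qed
  then have "card F = Suc (card (path_edges c))" using F by simp
  also have "\<dots> = length c" using card_path_edges[of c] c(1,2) by (cases c) auto
  finally show ?thesis using c by (simp add: distinct_card)
qed

text \<open>By counting: the union has as many edges as the cycle has vertices, and this is already
  the sum of the two path lengths.\<close>

lemma is_cycle_path_edges_disjoint:
  assumes "distinct (a # xs @ b # ys)" "xs \<noteq> [] \<or> ys \<noteq> []"
  shows "path_edges (a # xs @ [b]) \<inter> path_edges (b # ys @ [a]) = {}"
proof -
  let ?p = "a # xs @ [b]" and ?q = "b # ys @ [a]"
  have "card (path_edges ?p \<union> path_edges ?q) = card (set (a # xs @ b # ys))"
    using is_cycle_card[OF is_cycleI[OF assms]] .
  also have "\<dots> = length xs + length ys + 2" using distinct_card[OF assms(1)] by simp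
  also have "\<dots> = card (path_edges ?p) + card (path_edges ?q)"
    using card_path_edges[of ?p] card_path_edges[of ?q] assms(1) by auto
  finally show ?thesis
    using card_Un_Int[of "path_edges ?p" "path_edges ?q"] by simp
qed

lemma is_cycle_contains:
  assumes "is_cycle W F" "F \<subseteq> E"
  shows "contains_cycle E (card W)"
proof -
  obtain c where c: "distinct c" "3 \<le> length c" "W = set c" "F = path_edges (c @ [hd c])"
    using assms(1) unfolding is_cycle_def by blast
  have "{c ! i, c ! (Suc i mod length c)} \<in> E" if "i < length c" for i
  proof -
    have "{(c @ [hd c]) ! i, (c @ [hd c]) ! Suc i} \<in> F"
      using path_edges_nth[of i "c @ [hd c]"] that c(4) by simp
    moreover have "(c @ [hd c]) ! Suc i = c ! (Suc i mod length c)"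
    proof (cases "Suc i = length c")
      case True
      then show ?thesis by (cases c) (auto simp: nth_append)
    next
      case False
      then show ?thesis using that by (simp add: nth_append)
    qed
    ultimately show ?thesis using that assms(2) by (auto simp: nth_append)
  qed
  moreover have "card W = length c" using c by (simp add: distinct_card)
  ultimately show ?thesis unfolding contains_cycle_def using c by auto
qed

section \<open>Triangles as vertex sets\<close>

definition triangles :: "'a set set \<Rightarrow> 'a set set" where
  "triangles E = {t. card t = 3 \<and> (\<forall>e. e \<subseteq> t \<and> card e = 2 \<longrightarrow> e \<in> E)}"

lemma triangles_subset_Union: "t \<in> triangles E \<Longrightarrow> t \<subseteq> \<Union> E"
proof
  fix x assume t: "t \<in> triangles E" and x: "x \<in> t"
  then have "card (t - {x}) = 2" by (simp add: triangles_def)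
  then obtain y where "y \<in> t" "y \<noteq> x" by (auto simp: card_2_iff)
  then have "{x, y} \<in> E" using t x by (auto simp: triangles_def)
  then show "x \<in> \<Union> E" by blast
qed

lemma finite_triangles: "finite (\<Union> E) \<Longrightarrow> finite (triangles E)"
  by (rule finite_subset[of _ "Pow (\<Union> E)"]) (use triangles_subset_Union in auto)

lemma triangles_mono: "E \<subseteq> E' \<Longrightarrow> triangles E \<subseteq> triangles E'"
  unfolding triangles_def by auto

lemma triangles_Int: "triangles E \<inter> triangles E' = triangles (E \<inter> E')"
  unfolding triangles_def by auto

lemma triangles_path_edges: "distinct w \<Longrightarrow> triangles (path_edges w) = {}"
  using path_edges_no_triangle[of w] by (auto simp: triangles_def)

text \<open>A triangle of both parts would use common edges only. Triangles with edges in both parts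
  are lost, but they only help: triangles stand on the larger side of the edge bound.\<close>

lemma card_triangles_disjoint:
  assumes "finite (\<Union> E)" "E1 \<subseteq> E" "E2 \<subseteq> E" "triangles (E1 \<inter> E2) = {}"
  shows "card (triangles E1) + card (triangles E2) \<le> card (triangles E)"
proof -
  have fin: "finite (triangles E)" using finite_triangles assms(1) by auto
  then have "finite (triangles E1)" "finite (triangles E2)"
    using triangles_mono assms finite_subset by metis+
  then have "card (triangles E1) + card (triangles E2) = card (triangles E1 \<union> triangles E2)"
    using triangles_Int[of E1 E2] assms(4) by (simp add: card_Un_disjoint)
  also have "\<dots> \<le> card (triangles E)"
    using triangles_mono[OF assms(2)] triangles_mono[OF assms(3)] fin by (intro card_mono) auto
  finally show ?thesis .
qed

lemma is_cycle_triangle: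
  assumes "is_cycle W F" "card W = 3"
  shows "W \<in> triangles F"
proof -
  obtain c where c: "distinct c" "3 \<le> length c" "W = set c" "F = path_edges (c @ [hd c])"
    using assms(1) unfolding is_cycle_def by blast
  have "length c = 3" using c assms(2) by (simp add: distinct_card)
  then obtain x y z where xyz: "c = [x, y, z]"
    by (auto simp: numeral_3_eq_3 length_Suc_conv)
  have "e \<in> F" if "e \<subseteq> W" and "card e = 2" for e
  proof -
    obtain p q where "e = {p, q}" "p \<noteq> q" using \<open>card e = 2\<close> by (auto simp: card_2_iff)
    then show ?thesis using that c(3,4) xyz by (auto simp: insert_commute)
  qed
  then show ?thesis using assms(2) by (auto simp: triangles_def)
qed

text \<open>Whenever the walk returns to an old vertex it is cut back to that vertex. The quantified
  \<open>P\<close> lets each caller read off whatever its own relation says about the edges.\<close>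

lemma rtrancl_path:
  assumes "(a, b) \<in> r\<^sup>*"
  obtains w where "distinct w" "w \<noteq> []" "hd w = a" "last w = b" "set w \<subseteq> r\<^sup>* `` {a}"
    "\<And>P. (\<And>u v. (u, v) \<in> r \<Longrightarrow> P {u, v}) \<Longrightarrow> \<forall>e \<in> path_edges w. P e"
proof -
  from assms have "\<exists>w. distinct w \<and> w \<noteq> [] \<and> hd w = a \<and> last w = b \<and> set w \<subseteq> r\<^sup>* `` {a} \<and>
    (\<forall>e \<in> path_edges w. \<exists>u v. (u, v) \<in> r \<and> e = {u, v})"
  proof (induction rule: rtrancl_induct)
    case base
    show ?case by (intro exI[of _ "[a]"]) auto
  next
    case (step y z)
    then obtain w where w: "distinct w" "w \<noteq> []" "hd w = a" "last w = y" "set w \<subseteq> r\<^sup>* `` {a}"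
      "\<forall>e \<in> path_edges w. \<exists>u v. (u, v) \<in> r \<and> e = {u, v}" by blast
    show ?case
    proof (cases "z \<in> set w")
      case True
      then obtain us vs where uv: "w = us @ z # vs" by (metis split_list)
      then have "path_edges (us @ [z]) \<subseteq> path_edges w"
        using path_edges_append[of us z vs] by auto
      then show ?thesis using w uv by (intro exI[of _ "us @ [z]"]) (auto simp: hd_append)
    next
      case False
      obtain us where us: "w = us @ [y]" using w(2,4) by (metis append_butlast_last_id)
      have "path_edges (w @ [z]) = path_edges w \<union> {{y, z}}"
        using path_edges_append[of us y "[z]"] us by auto
      moreover have "z \<in> r\<^sup>* `` {a}" using step by auto
      ultimately show ?thesis using w False step(2)
        by (intro exI[of _ "w @ [z]"]) (auto simp: hd_append)
    qed
  qed
  then show ?thesis using that by metis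
qed

section \<open>Planar drawings\<close>

text \<open>The ends of an arc are limits of its inner points. This transfers the side of a closed
  curve between an edge and its end vertices.\<close>

lemma arc_image_subset_closure:
  fixes g :: "real \<Rightarrow> 'a::real_normed_vector"
  assumes "arc g"
  shows "path_image g \<subseteq> closure (path_image g - {pathstart g, pathfinish g})"
proof -
  have "continuous_on {0..1} g" using assms by (simp add: arc_def path_def)
  moreover have "closure {0<..<1::real} = {0..1}" by simp
  ultimately have "g ` closure {0<..<1} \<subseteq> closure (g ` {0<..<1})"
    by (intro image_closure_subset) (auto intro: closure_subset[THEN subsetD])
  then show ?thesis
    using simple_path_endless[OF arc_imp_simple_path[OF assms]] by (simp add: path_image_def)
qed

locale drawn_graph =
  fixes V :: "'a set" and E :: "'a set set" and pos :: "'a \<Rightarrow> complex"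
    and \<gamma> :: "'a set \<Rightarrow> real \<Rightarrow> complex"
  assumes simple: "simple_graph V E" and drawing: "planar_drawing V E pos \<gamma>"
begin

definition img :: "'a set set \<Rightarrow> complex set" where
  "img F = (\<Union>e\<in>F. path_image (\<gamma> e))"

definition open_edge :: "'a set \<Rightarrow> complex set" where
  "open_edge e = path_image (\<gamma> e) - pos ` e"

text \<open>Since \<open>inside\<close> omits the curve itself, the cycle's own edges are added;
  this makes the inner domain a closed one. The same holds for the vertices below.\<close>

definition enclosed_edges :: "'a set set \<Rightarrow> 'a set set" where
  "enclosed_edges F = {e \<in> E. e \<in> F \<or> open_edge e \<subseteq> inside (img F)}"

definition enclosed_vertices :: "'a set set \<Rightarrow> 'a set" where
  "enclosed_vertices F = {v \<in> V. v \<in> \<Union> F \<or> pos v \<in> inside (img F)}"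

lemma finite_V: "finite V" and edge_subset: "e \<in> E \<Longrightarrow> e \<subseteq> V" and edge_card: "e \<in> E \<Longrightarrow> card e = 2"
  using simple by (auto simp: simple_graph_def)

lemma finite_E: "finite E"
  using finite_V edge_subset by (meson Pow_iff finite_Pow_iff finite_subset subsetI)

lemma inj_pos: "inj_on pos V"
  using drawing by (simp add: planar_drawing_def)

lemma arc_edge: "e \<in> E \<Longrightarrow> arc (\<gamma> e)"
  and ends_edge: "e \<in> E \<Longrightarrow> {pathstart (\<gamma> e), pathfinish (\<gamma> e)} = pos ` e"
  and edge_Int_V: "e \<in> E \<Longrightarrow> path_image (\<gamma> e) \<inter> pos ` V = pos ` e"
  and edge_Int_edge:
    "e \<in> E \<Longrightarrow> e' \<in> E \<Longrightarrow> e \<noteq> e' \<Longrightarrow> path_image (\<gamma> e) \<inter> path_image (\<gamma> e') = pos ` (e \<inter> e')"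
  using drawing by (simp_all add: planar_drawing_def)

lemma img_Un [simp]: "img (F \<union> G) = img F \<union> img G"
  by (auto simp: img_def)

lemma pos_in_img: "F \<subseteq> E \<Longrightarrow> v \<in> V \<Longrightarrow> pos v \<in> img F \<longleftrightarrow> v \<in> \<Union> F"
proof -
  assume F: "F \<subseteq> E" and v: "v \<in> V"
  have "pos v \<in> path_image (\<gamma> e) \<longleftrightarrow> v \<in> e" if "e \<in> F" for e
  proof -
    have "e \<in> E" using F that by auto
    then have "pos v \<in> path_image (\<gamma> e) \<longleftrightarrow> pos v \<in> pos ` e"
      using edge_Int_V[of e] v by blast
    also have "\<dots> \<longleftrightarrow> v \<in> e"
      using inj_on_image_mem_iff[OF inj_pos v edge_subset] \<open>e \<in> E\<close> by auto
    finally show ?thesis .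
  qed
  then show ?thesis by (auto simp: img_def)
qed

lemma
  assumes "e \<in> E"
  shows connected_open_edge: "connected (open_edge e)"
    and open_edge_nonempty: "open_edge e \<noteq> {}"
    and edge_subset_closure: "path_image (\<gamma> e) \<subseteq> closure (open_edge e)"
  using connected_simple_path_endless[OF arc_imp_simple_path[OF arc_edge[OF assms]]]
    nonempty_simple_path_endless[OF arc_imp_simple_path[OF arc_edge[OF assms]]]
    arc_image_subset_closure[OF arc_edge[OF assms]]
  by (simp_all add: ends_edge[OF assms] open_edge_def)

lemma edge_Int_img:
  "e \<in> E \<Longrightarrow> F \<subseteq> E \<Longrightarrow> e \<notin> F \<Longrightarrow> path_image (\<gamma> e) \<inter> img F = pos ` (e \<inter> \<Union> F)"
  using edge_Int_edge by (fastforce simp: img_def)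

lemma open_edge_Int_img:
  assumes "e \<in> E" "F \<subseteq> E" "e \<notin> F"
  shows "open_edge e \<inter> img F = {}"
  using edge_Int_img[OF assms] by (auto simp: open_edge_def)

lemma img_Int:
  assumes "F \<subseteq> E" "G \<subseteq> E" "F \<inter> G = {}"
  shows "img F \<inter> img G = pos ` (\<Union> F \<inter> \<Union> G)"
proof -
  have "img F \<inter> img G = (\<Union>e\<in>F. path_image (\<gamma> e) \<inter> img G)" by (auto simp: img_def)
  also have "\<dots> = (\<Union>e\<in>F. pos ` (e \<inter> \<Union> G))"
  proof (rule SUP_cong[OF refl])
    fix e assume "e \<in> F"
    then have "e \<in> E" "e \<notin> G" using assms by auto
    then show "path_image (\<gamma> e) \<inter> img G = pos ` (e \<inter> \<Union> G)"
      using edge_Int_img assms(2) by simp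
  qed
  finally show ?thesis by auto
qed

text \<open>The arcs of successive edges are concatenated, each reversed if it happens to be drawn
  in the wrong direction.\<close>

lemma path_arc:
  "2 \<le> length w \<Longrightarrow> distinct w \<Longrightarrow> path_edges w \<subseteq> E \<Longrightarrow>
    \<exists>g. arc g \<and> pathstart g = pos (hd w) \<and> pathfinish g = pos (last w) \<and>
        path_image g = img (path_edges w)"
proof (induction w rule: path_edges.induct)
  case (1 x y zs)
  have e: "{x, y} \<in> E" using 1 by auto
  obtain h where h: "arc h" "pathstart h = pos x" "pathfinish h = pos y"
    "path_image h = path_image (\<gamma> {x, y})"
  proof -
    have "{pathstart (\<gamma> {x, y}), pathfinish (\<gamma> {x, y})} = {pos x, pos y}"
      using ends_edge[OF e] by simp
    then consider "pathstart (\<gamma> {x, y}) = pos x" "pathfinish (\<gamma> {x, y}) = pos y"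
      | "pathstart (\<gamma> {x, y}) = pos y" "pathfinish (\<gamma> {x, y}) = pos x"
      by (auto simp: doubleton_eq_iff)
    then show ?thesis
    proof cases
      case 1
      then show ?thesis using that arc_edge[OF e] by blast
    next
      case 2
      then show ?thesis using that[of "reversepath (\<gamma> {x, y})"] arc_edge[OF e]
        by (simp add: arc_reversepath)
    qed
  qed
  show ?case
  proof (cases zs)
    case Nil
    then show ?thesis using h by (intro exI[of _ h]) (auto simp: img_def)
  next
    case (Cons z zs')
    then obtain g where g: "arc g" "pathstart g = pos y" "pathfinish g = pos (last (y # zs))"
      "path_image g = img (path_edges (y # zs))"
      using 1 by auto
    have "{x, y} \<notin> path_edges (y # zs)"
      using 1 path_edges_subset[of "{x, y}" "y # zs"] by auto
    then have "path_image h \<inter> path_image g = pos ` ({x, y} \<inter> \<Union> (path_edges (y # zs)))"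
      unfolding h g by (intro edge_Int_img) (use 1 e in auto)
    also have "\<dots> \<subseteq> {pos y}"
      using Union_path_edges[of "y # zs"] Cons 1 by auto
    finally have "arc (h +++ g)" using h g by (intro arc_join) auto
    then show ?thesis
      using h g by (intro exI[of _ "h +++ g"]) (auto simp: path_image_join img_def)
  qed
qed auto

lemma cycle_curve:
  assumes "is_cycle W F" "F \<subseteq> E"
  obtains c where "simple_path c" "pathfinish c = pathstart c" "path_image c = img F"
proof -
  obtain a b where ab: "a \<in> W" "b \<in> W" "a \<noteq> b"
    using is_cycle_card_ge[OF assms(1)] card_le_Suc0_iff_eq[of W] is_cycle_finite[OF assms(1)]
    by force
  obtain xs ys where s: "distinct (a # xs @ b # ys)" "W = set (a # xs @ b # ys)"
    "F = path_edges (a # xs @ [b]) \<union> path_edges (b # ys @ [a])" "xs \<noteq> [] \<or> ys \<noteq> []"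
    using is_cycle_split[OF assms(1) ab] by metis
  let ?p = "a # xs @ [b]" and ?q = "b # ys @ [a]"
  have d: "path_edges ?p \<inter> path_edges ?q = {}"
    using is_cycle_path_edges_disjoint[OF s(1,4)] .
  obtain g where g: "arc g" "pathstart g = pos a" "pathfinish g = pos b"
    "path_image g = img (path_edges ?p)"
    using path_arc[of ?p] s assms(2) by auto
  obtain h where h: "arc h" "pathstart h = pos b" "pathfinish h = pos a"
    "path_image h = img (path_edges ?q)"
    using path_arc[of ?q] s assms(2) by auto
  have "path_image g \<inter> path_image h = pos ` (\<Union> (path_edges ?p) \<inter> \<Union> (path_edges ?q))"
    unfolding g h using d s assms(2) by (intro img_Int) auto
  also have "\<dots> = pos ` {a, b}"
    using s(1) Union_path_edges[of ?p] Union_path_edges[of ?q] by (intro arg_cong[of _ _ "image pos"]) auto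
  finally have "simple_path (g +++ h)"
    using g h by (intro simple_path_join_loop) auto
  then show ?thesis using that[of "g +++ h"] g h s(3) by (auto simp: path_image_join)
qed

section \<open>Inside and outside of a cycle\<close>

lemma
  assumes "is_cycle W F" "F \<subseteq> E"
  shows open_inside_cycle: "open (inside (img F))"
    and open_outside_cycle: "open (outside (img F))"
    and connected_outside_cycle: "connected (outside (img F))"
    and connected_inside_cycle: "connected (inside (img F))"
    and inside_cycle_nonempty: "inside (img F) \<noteq> {}"
    and bounded_inside_cycle: "bounded (inside (img F))"
    and closed_img_cycle: "closed (img F)"
proof -
  obtain c where c: "simple_path c" "pathfinish c = pathstart c" "path_image c = img F"
    using cycle_curve[OF assms] .
  note J = Jordan_inside_outside[OF c(1,2), unfolded c(3)]
  show "open (inside (img F))" "open (outside (img F))" "connected (outside (img F))"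
    "connected (inside (img F))" "inside (img F) \<noteq> {}" "bounded (inside (img F))"
    using J by simp_all
  show "closed (img F)"
    using closed_simple_path_image[OF c(1)] c(3) by simp
qed

text \<open>An open edge is connected and avoids the curve, so it cannot meet both sides.\<close>

lemma open_edge_side:
  assumes "is_cycle W F" "F \<subseteq> E" "e \<in> E" "e \<notin> F" "open_edge e \<inter> inside (img F) \<noteq> {}"
  shows "open_edge e \<subseteq> inside (img F)"
proof -
  have sub: "open_edge e \<subseteq> inside (img F) \<union> outside (img F)"
    using open_edge_Int_img[OF assms(3,2,4)] by auto
  then have "inside (img F) \<inter> open_edge e = {} \<or> outside (img F) \<inter> open_edge e = {}"
    by (intro connectedD[OF connected_open_edge[OF assms(3)] open_inside_cycle[OF assms(1,2)]
      open_outside_cycle[OF assms(1,2)]]) (use inside_Int_outside[of "img F"] in auto)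
  then show ?thesis using sub assms(5) inside_Un_outside[of "img F"] by blast
qed

text \<open>The inside is open and the vertex is a limit of the open edge, so the edge enters the
  inside and then stays there.\<close>

lemma pos_inside_imp_open_edge:
  assumes "is_cycle W F" "F \<subseteq> E" "e \<in> E" "v \<in> e" "pos v \<in> inside (img F)"
  shows "open_edge e \<subseteq> inside (img F)"
proof -
  have v: "v \<in> V" using assms edge_subset by auto
  have "pos v \<notin> img F" using assms(5) inside_no_overlap by blast
  then have "e \<notin> F" using pos_in_img[OF assms(2) v] assms(4) by auto
  have "pos v \<in> path_image (\<gamma> e)" using edge_Int_V[OF assms(3)] assms(4) by blast
  then have "pos v \<in> closure (open_edge e)" using edge_subset_closure[OF assms(3)] by auto
  then have "open_edge e \<inter> inside (img F) \<noteq> {}"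
    using open_inside_cycle[OF assms(1,2)] assms(5) open_Int_closure_eq_empty by blast
  then show ?thesis using open_edge_side assms \<open>e \<notin> F\<close> by blast
qed

text \<open>Taking the closure of the inside adds only points of the curve, and the vertices on the
  curve are those of \<open>W\<close>.\<close>

lemma open_edge_inside_imp_pos:
  assumes "is_cycle W F" "F \<subseteq> E" "e \<in> E" "v \<in> e" "v \<notin> W" "open_edge e \<subseteq> inside (img F)"
  shows "pos v \<in> inside (img F)"
proof -
  have v: "v \<in> V" using assms edge_subset by auto
  have "pos v \<in> path_image (\<gamma> e)" using edge_Int_V[OF assms(3)] assms(4) by blast
  then have "pos v \<in> closure (open_edge e)" using edge_subset_closure[OF assms(3)] by auto
  then have "pos v \<in> closure (inside (img F))" using closure_mono[OF assms(6)] by auto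
  then have "pos v \<in> img F \<union> inside (img F)"
    using closure_inside_subset[OF closed_img_cycle[OF assms(1,2)]] by auto
  then show ?thesis using pos_in_img[OF assms(2) v] is_cycle_Union[OF assms(1)] assms(5) by auto
qed

text \<open>The path and the two arcs of the cycle between \<open>a\<close> and \<open>b\<close>
  form a theta graph: the inside of the cycle is the disjoint union of the insides of the two new
  cycles and the path without its ends. Edges and vertices are distributed accordingly, with exactly
  the path shared.\<close>

lemma split_cycle:
  assumes cyc: "is_cycle W F" "F \<subseteq> E"
    and p: "distinct p" "hd p = a" "last p = b" "a \<noteq> b" "set p \<inter> W = {a, b}"
      "path_edges p \<subseteq> E" "path_edges p \<inter> F = {}"
    and inner: "\<And>e. e \<in> path_edges p \<Longrightarrow> open_edge e \<subseteq> inside (img F)"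
  obtains W1 F1 W2 F2 where "is_cycle W1 F1" "F1 \<subseteq> E" "is_cycle W2 F2" "F2 \<subseteq> E"
    "enclosed_edges F1 \<union> enclosed_edges F2 = enclosed_edges F"
    "enclosed_edges F1 \<inter> enclosed_edges F2 = path_edges p"
    "enclosed_vertices F1 \<union> enclosed_vertices F2 = enclosed_vertices F"
    "enclosed_vertices F1 \<inter> enclosed_vertices F2 = set p"
    "card F1 + card F2 = card F + 2 * card (path_edges p)"
    "enclosed_edges F1 \<subset> enclosed_edges F" "enclosed_edges F2 \<subset> enclosed_edges F"
proof -
  define P where "P = path_edges p"
  have PE: "P \<subseteq> E" and PF: "P \<inter> F = {}" using p by (auto simp: P_def)
  obtain ys where ps: "p = a # ys @ [b]"
  proof -
    have "p \<noteq> []" using p by auto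
    then obtain r where r: "p = a # r" using p(2) by (cases p) auto
    then have "r \<noteq> []" using p(3,4) by auto
    then have "r = butlast r @ [b]" using p(3) r by (metis append_butlast_last_id last_ConsR)
    then show ?thesis using that r by blast
  qed
  have abW: "a \<in> W" "b \<in> W" using p by auto
  obtain xs zs where s: "distinct (a # xs @ b # zs)" "W = set (a # xs @ b # zs)"
    "F = path_edges (a # xs @ [b]) \<union> path_edges (b # zs @ [a])" "xs \<noteq> [] \<or> zs \<noteq> []"
    using is_cycle_split[OF cyc(1) abW p(4)] by metis
  define A B where "A = path_edges (a # xs @ [b])" and "B = path_edges (b # zs @ [a])"
  have F: "F = A \<union> B" and AE: "A \<subseteq> E" and BE: "B \<subseteq> E" using s(3) cyc(2) by (auto simp: A_def B_def)
  have AB: "A \<inter> B = {}" unfolding A_def B_def using is_cycle_path_edges_disjoint[OF s(1,4)] .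
  have PA: "P \<inter> A = {}" and PB: "P \<inter> B = {}" using PF F by auto
  have UA: "\<Union> A = set (a # xs @ [b])" and UB: "\<Union> B = set (b # zs @ [a])" and UP: "\<Union> P = set p"
    using Union_path_edges[of "a # xs @ [b]"] Union_path_edges[of "b # zs @ [a]"]
      Union_path_edges[of p] ps by (auto simp: A_def B_def P_def)
  have Prev: "P = path_edges (b # rev ys @ [a])"
    using path_edges_rev[of p] ps by (simp add: P_def)
  have edge_ab: "path_edges [a, b] = {{a, b}}" "path_edges [b, a] = {{a, b}}"
    by (auto simp: insert_commute)
  \<comment> \<open>The path has no edge of the cycle, so path and arc are not both the single edge
    \<open>{a, b}\<close>, and together they have at least three vertices.\<close>
  have xy: "xs \<noteq> [] \<or> ys \<noteq> []"
    using PA ps edge_ab by (auto simp: P_def A_def)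
  have zy: "zs \<noteq> [] \<or> ys \<noteq> []"
    using PB ps edge_ab by (auto simp: P_def B_def)
  have dist1: "distinct (a # xs @ b # rev ys)" and dist2: "distinct (a # ys @ b # zs)"
    using s(1,2) p(1,5) ps by auto
  define F1 F2 where "F1 = A \<union> P" and "F2 = B \<union> P"
  have "is_cycle (set (a # xs @ b # rev ys)) F1"
    using is_cycleI[OF dist1] xy by (auto simp: F1_def A_def Prev)
  then have cyc1: "is_cycle (\<Union> F1) F1"
    by (metis is_cycle_Union)
  have "F2 = path_edges (a # ys @ [b]) \<union> path_edges (b # zs @ [a])"
    by (auto simp: F2_def B_def P_def ps)
  then have "is_cycle (set (a # ys @ b # zs)) F2"
    using is_cycleI[OF dist2] zy by metis
  then have cyc2: "is_cycle (\<Union> F2) F2"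
    by (metis is_cycle_Union)
  have F1E: "F1 \<subseteq> E" and F2E: "F2 \<subseteq> E" using AE BE PE by (auto simp: F1_def F2_def)
  obtain g1 where g1: "arc g1" "pathstart g1 = pos a" "pathfinish g1 = pos b" "path_image g1 = img A"
    using path_arc[of "a # xs @ [b]"] s(1) AE by (auto simp: A_def)
  obtain g2' where g2': "arc g2'" "pathstart g2' = pos b" "pathfinish g2' = pos a" "path_image g2' = img B"
    using path_arc[of "b # zs @ [a]"] s(1) BE by (auto simp: B_def)
  define g2 where "g2 = reversepath g2'"
  have g2: "arc g2" "pathstart g2 = pos a" "pathfinish g2 = pos b" "path_image g2 = img B"
    using g2' by (auto simp: g2_def arc_reversepath)
  obtain g where g: "arc g" "pathstart g = pos a" "pathfinish g = pos b" "path_image g = img P"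
    using path_arc[of p] p(1) PE ps by (auto simp: P_def)
  have pab: "pos a \<noteq> pos b"
    using g arc_distinct_ends by metis
  have imgAB: "img A \<inter> img B = {pos a, pos b}"
  proof -
    have "\<Union> A \<inter> \<Union> B = {a, b}" unfolding UA UB using s(1) by auto
    then show ?thesis using img_Int[OF AE BE AB] by simp
  qed
  have imgAP: "img A \<inter> img P = {pos a, pos b}"
  proof -
    have "\<Union> A \<inter> \<Union> P = {a, b}" unfolding UA UP using s(2) p(5) ps by auto
    then show ?thesis using img_Int[OF AE PE] PA by auto
  qed
  have imgBP: "img B \<inter> img P = {pos a, pos b}"
  proof -
    have "\<Union> B \<inter> \<Union> P = {a, b}" unfolding UB UP using s(2) p(5) ps by auto
    then show ?thesis using img_Int[OF BE PE] PB by auto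
  qed
  obtain e0 where e0: "e0 \<in> P" using ps by (cases ys) (auto simp: P_def)
  have ne: "img P \<inter> inside (img A \<union> img B) \<noteq> {}"
  proof -
    have "open_edge e0 \<subseteq> inside (img F)" using inner e0 by (auto simp: P_def)
    moreover have "open_edge e0 \<noteq> {}" "open_edge e0 \<subseteq> img P"
      using open_edge_nonempty e0 PE by (auto simp: open_edge_def img_def)
    ultimately show ?thesis by (auto simp: F)
  qed
  obtain disj: "inside (img A \<union> img P) \<inter> inside (img B \<union> img P) = {}"
    and cover: "inside (img A \<union> img P) \<union> inside (img B \<union> img P) \<union> (img P - {pos a, pos b})
      = inside (img A \<union> img B)"
    using split_inside_simple_closed_curve[of g1 "pos a" "pos b" g2 g]
      g1 g2 g pab imgAB imgAP imgBP ne by (metis arc_imp_simple_path)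
  have disj: "inside (img F1) \<inter> inside (img F2) = {}"
    and cover: "inside (img F1) \<union> inside (img F2) \<union> (img P - {pos a, pos b}) = inside (img F)"
    using disj cover by (auto simp: F1_def F2_def F)
  have edges: "enclosed_edges F1 \<union> enclosed_edges F2 = enclosed_edges F"
  proof (intro equalityI subsetI)
    fix e assume e: "e \<in> enclosed_edges F1 \<union> enclosed_edges F2"
    then show "e \<in> enclosed_edges F"
      using cover inner unfolding enclosed_edges_def F F1_def F2_def P_def by blast
  next
    fix e assume e: "e \<in> enclosed_edges F"
    then have eE: "e \<in> E" by (simp add: enclosed_edges_def)
    show "e \<in> enclosed_edges F1 \<union> enclosed_edges F2"
    proof (cases "e \<in> F1 \<union> F2")
      case True
      then show ?thesis using eE by (auto simp: enclosed_edges_def)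
    next
      case False
      then have "e \<notin> F" "e \<notin> P" by (auto simp: F F1_def F2_def)
      then have "open_edge e \<subseteq> inside (img F)" using e by (auto simp: enclosed_edges_def)
      moreover have "open_edge e \<inter> img P = {}" using open_edge_Int_img[OF eE PE \<open>e \<notin> P\<close>] .
      ultimately have "open_edge e \<subseteq> inside (img F1) \<union> inside (img F2)" using cover by auto
      then have "open_edge e \<subseteq> inside (img F1) \<or> open_edge e \<subseteq> inside (img F2)"
        using open_edge_side[OF cyc1 F1E eE] open_edge_side[OF cyc2 F2E eE] False
          open_edge_nonempty[OF eE] by blast
      then show ?thesis using eE by (auto simp: enclosed_edges_def)
    qed
  qed
  have F12: "F1 \<inter> F2 = P" using AB by (auto simp: F1_def F2_def)
  have not_inside: "\<not> open_edge e \<subseteq> inside (img F1)" "\<not> open_edge e \<subseteq> inside (img F2)"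
    if "e \<in> F" for e
  proof -
    have "e \<in> E" using that cyc(2) by auto
    then have "open_edge e \<noteq> {}" using open_edge_nonempty by auto
    moreover have "open_edge e \<subseteq> img F" using that by (auto simp: open_edge_def img_def)
    then have "open_edge e \<inter> inside (img F) = {}" using inside_no_overlap by blast
    ultimately show "\<not> open_edge e \<subseteq> inside (img F1)" "\<not> open_edge e \<subseteq> inside (img F2)"
      using cover by auto
  qed
  have edges_Int: "enclosed_edges F1 \<inter> enclosed_edges F2 = P"
  proof (intro equalityI subsetI)
    fix e assume e: "e \<in> enclosed_edges F1 \<inter> enclosed_edges F2"
    then have eE: "e \<in> E" by (auto simp: enclosed_edges_def)
    show "e \<in> P"
    proof (rule ccontr)
      assume "e \<notin> P"
      show False
      proof (cases "e \<in> F")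
        case True
        then show False using e not_inside[OF True] \<open>e \<notin> P\<close> AB
          by (auto simp: enclosed_edges_def F1_def F2_def)
      next
        case False
        then show False using e \<open>e \<notin> P\<close> disj open_edge_nonempty[OF eE]
          by (auto simp: enclosed_edges_def F1_def F2_def F)
      qed
    qed
  next
    fix e assume "e \<in> P"
    then show "e \<in> enclosed_edges F1 \<inter> enclosed_edges F2"
      using PE by (auto simp: enclosed_edges_def F1_def F2_def)
  qed
  have UF: "\<Union> F = W" using is_cycle_Union[OF cyc(1)] .
  have pV: "set p \<subseteq> V" using UP PE edge_subset by blast
  have pos_P: "pos v \<in> img P - {pos a, pos b} \<longleftrightarrow> v \<in> set p - {a, b}" if "v \<in> V" for v
  proof -
    have "a \<in> V" "b \<in> V" using pV ps by auto
    then have "pos v \<in> {pos a, pos b} \<longleftrightarrow> v \<in> {a, b}"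
      using inj_pos that by (auto dest: inj_onD)
    then show ?thesis using pos_in_img[OF PE that] UP by auto
  qed
  have UF1: "\<Union> F1 = \<Union> A \<union> set p" and UF2: "\<Union> F2 = \<Union> B \<union> set p"
    and WAB: "W = \<Union> A \<union> \<Union> B"
    using UP UF by (auto simp: F1_def F2_def F)
  have verts: "enclosed_vertices F1 \<union> enclosed_vertices F2 = enclosed_vertices F"
  proof (intro equalityI subsetI)
    fix v assume v: "v \<in> enclosed_vertices F1 \<union> enclosed_vertices F2"
    then have "v \<in> V" by (auto simp: enclosed_vertices_def)
    have "v \<in> W \<or> v \<in> set p - {a, b} \<or> pos v \<in> inside (img F1) \<or> pos v \<in> inside (img F2)"
      using v abW WAB UF1 UF2 by (auto simp: enclosed_vertices_def)
    then show "v \<in> enclosed_vertices F"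
      using cover pos_P[OF \<open>v \<in> V\<close>] UF \<open>v \<in> V\<close> by (auto simp: enclosed_vertices_def)
  next
    fix v assume v: "v \<in> enclosed_vertices F"
    then have "v \<in> V" by (auto simp: enclosed_vertices_def)
    then have "v \<in> W \<or> v \<in> set p \<or> pos v \<in> inside (img F1) \<or> pos v \<in> inside (img F2)"
      using v cover pos_P[of v] UF by (auto simp: enclosed_vertices_def)
    then show "v \<in> enclosed_vertices F1 \<union> enclosed_vertices F2"
      using \<open>v \<in> V\<close> WAB UF1 UF2 by (auto simp: enclosed_vertices_def)
  qed
  have verts_Int: "enclosed_vertices F1 \<inter> enclosed_vertices F2 = set p"
  proof (intro equalityI subsetI)
    fix v assume v: "v \<in> enclosed_vertices F1 \<inter> enclosed_vertices F2"
    then have vV: "v \<in> V" by (auto simp: enclosed_vertices_def)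
    show "v \<in> set p"
    proof (rule ccontr)
      assume np: "v \<notin> set p"
      show False
      proof (cases "v \<in> W")
        case True
        then have "pos v \<in> img F" using pos_in_img[OF cyc(2) vV] UF by auto
        then have "pos v \<notin> inside (img F)" using inside_no_overlap by blast
        then have "v \<in> \<Union> F1" "v \<in> \<Union> F2" using v cover by (auto simp: enclosed_vertices_def)
        then have "v \<in> \<Union> A" "v \<in> \<Union> B" using np UF1 UF2 by auto
        then show False unfolding UA UB using s(1) np ps by auto
      next
        case False
        then have "v \<notin> \<Union> F1" "v \<notin> \<Union> F2" using np UF1 UF2 WAB by auto
        then show False using v disj by (auto simp: enclosed_vertices_def)
      qed
    qed
  next
    fix v assume "v \<in> set p"
    then show "v \<in> enclosed_vertices F1 \<inter> enclosed_vertices F2"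
      using pV UF1 UF2 by (auto simp: enclosed_vertices_def)
  qed
  have fin: "finite A" "finite B" "finite P" by (auto simp: A_def B_def P_def)
  have cards: "card F1 + card F2 = card F + 2 * card P"
    using fin AB PA PB unfolding F1_def F2_def F by (simp add: card_Un_disjoint Int_commute)
  \<comment> \<open>Each new cycle loses the arc that belongs to the other one; this gives the
    strict decrease that later inductions need.\<close>
  have "A \<noteq> {}" by (cases xs) (auto simp: A_def)
  moreover have "B \<noteq> {}" by (cases zs) (auto simp: B_def)
  moreover have "A \<subseteq> enclosed_edges F1" "B \<subseteq> enclosed_edges F2"
    using AE BE by (auto simp: enclosed_edges_def F1_def F2_def)
  ultimately have "enclosed_edges F1 \<subset> enclosed_edges F" "enclosed_edges F2 \<subset> enclosed_edges F"
    using edges edges_Int PA PB by blast+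
  then show ?thesis
    using that[OF cyc1 F1E cyc2 F2E edges edges_Int[unfolded P_def] verts verts_Int
        cards[unfolded P_def]] by blast
qed

end

section \<open>The edge bound\<close>

text \<open>Connected and without cut vertex, phrased by separations of order at most one because
  these are the cuts along which the edge bound adds up.\<close>

definition inseparable :: "'a set \<Rightarrow> 'a set set \<Rightarrow> bool" where
  "inseparable V E \<longleftrightarrow>
     (\<forall>A B. A \<union> B = V \<and> card (A \<inter> B) \<le> 1 \<and> (\<forall>e\<in>E. e \<subseteq> A \<or> e \<subseteq> B) \<longrightarrow> A = V \<or> B = V)"

context drawn_graph
begin

text \<open>An enclosed edge is a chord or has an end off the cycle. In the second case the
  component of that end after deletion of \<open>W\<close> stays inside. If it were attached to the
  cycle at no more than one vertex, that vertex would separate the graph; so a path through the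
  component joins two cycle vertices.\<close>

lemma enclosed_path:
  assumes cyc: "is_cycle W F" "F \<subseteq> E" and insep: "inseparable V E"
    and e: "e \<in> enclosed_edges F" "e \<notin> F"
  obtains p a b where "distinct p" "hd p = a" "last p = b" "a \<noteq> b" "set p \<inter> W = {a, b}"
    "path_edges p \<subseteq> E" "path_edges p \<inter> F = {}"
    "\<And>e. e \<in> path_edges p \<Longrightarrow> open_edge e \<subseteq> inside (img F)"
proof (cases "e \<subseteq> W")
  case True
  have eE: "e \<in> E" and ein: "open_edge e \<subseteq> inside (img F)" using e by (auto simp: enclosed_edges_def)
  obtain x y where "e = {x, y}" "x \<noteq> y" using edge_card[OF eE] by (auto simp: card_2_iff)
  then show ?thesis using that[of "[x, y]" x y] True eE ein e(2) by auto
next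
  case False
  then obtain x where x: "x \<in> e" "x \<notin> W" by auto
  have eE: "e \<in> E" and ein: "open_edge e \<subseteq> inside (img F)" using e by (auto simp: enclosed_edges_def)
  have xV: "x \<in> V" using x eE edge_subset by auto
  define r where "r = {(u, v). {u, v} \<in> E \<and> u \<notin> W \<and> v \<notin> W}"
  define S where "S = r\<^sup>* `` {x}"
  have S: "s \<in> V \<and> s \<notin> W \<and> pos s \<in> inside (img F)" if "s \<in> S" for s
  proof -
    from that have "(x, s) \<in> r\<^sup>*" by (simp add: S_def)
    then show ?thesis
    proof (induction rule: rtrancl_induct)
      case base
      then show ?case using x xV open_edge_inside_imp_pos[OF cyc eE x ein] by simp
    next
      case (step u v)
      then have uv: "{u, v} \<in> E" "v \<notin> W" by (auto simp: r_def)
      have "open_edge {u, v} \<subseteq> inside (img F)"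
        using pos_inside_imp_open_edge[OF cyc uv(1), of u] step by simp
      then have "pos v \<in> inside (img F)"
        using open_edge_inside_imp_pos[OF cyc uv(1), of v] uv(2) by simp
      then show ?case using uv edge_subset[OF uv(1)] by auto
    qed
  qed
  have xS: "x \<in> S" by (simp add: S_def)
  \<comment> \<open>\<open>A - S\<close> consists of the attachments of the component
    \<open>S\<close> to the cycle, and \<open>A\<close> and \<open>V - S\<close> form a separation
    that has exactly them in common.\<close>
  define A where "A = S \<union> {w. \<exists>s\<in>S. {s, w} \<in> E}"
  have AW: "A - S \<subseteq> W"
  proof
    fix w assume w: "w \<in> A - S"
    then obtain s where s: "s \<in> S" "{s, w} \<in> E" by (auto simp: A_def)
    show "w \<in> W"
    proof (rule ccontr)
      assume "w \<notin> W"
      then have "(s, w) \<in> r" using s S by (auto simp: r_def)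
      then have "w \<in> S" using s(1) by (auto simp: S_def intro: rtrancl_into_rtrancl)
      then show False using w by simp
    qed
  qed
  have AV: "A \<subseteq> V" using S edge_subset by (fastforce simp: A_def)
  have edges: "f \<subseteq> A \<or> f \<subseteq> V - S" if f: "f \<in> E" for f
  proof (cases "f \<inter> S = {}")
    case True
    then show ?thesis using edge_subset[OF f] by auto
  next
    case False
    then obtain s where s: "s \<in> f" "s \<in> S" by auto
    obtain t where "f = {s, t}" using edge_card[OF f] s(1) by (auto simp: card_2_iff)
    then show ?thesis using s f by (auto simp: A_def)
  qed
  have "\<not> card (A \<inter> (V - S)) \<le> 1"
  proof
    assume c: "card (A \<inter> (V - S)) \<le> 1"
    have "A \<union> (V - S) = V" using AV by (auto simp: A_def)
    then have "A = V \<or> V - S = V"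
      using insep c edges unfolding inseparable_def by blast
    then have "A = V" using xS xV by auto
    have "W \<subseteq> V" using is_cycle_Union[OF cyc(1)] cyc(2) edge_subset by blast
    then have "W \<subseteq> A \<inter> (V - S)" using \<open>A = V\<close> S by auto
    then have "card W \<le> 1" using c finite_V card_mono[of "A \<inter> (V - S)" W] by auto
    then show False using is_cycle_card_ge[OF cyc(1)] by simp
  qed
  moreover have "finite (A \<inter> (V - S))" using finite_V by auto
  ultimately obtain a b where ab: "a \<in> A - S" "b \<in> A - S" "a \<noteq> b"
    using card_le_Suc0_iff_eq[of "A \<inter> (V - S)"] by auto
  obtain s t where s: "s \<in> S" "{s, a} \<in> E" and t: "t \<in> S" "{t, b} \<in> E"
    using ab by (auto simp: A_def)
  have "sym r" by (auto simp: r_def sym_def insert_commute)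
  then have "sym (r\<^sup>*)" by (rule sym_rtrancl)
  have "(s, x) \<in> r\<^sup>*" using s(1) \<open>sym (r\<^sup>*)\<close> by (auto simp: S_def dest: symD)
  then have "(s, t) \<in> r\<^sup>*" using t(1) by (auto simp: S_def)
  then obtain w where w: "distinct w" "w \<noteq> []" "hd w = s" "last w = t" "set w \<subseteq> r\<^sup>* `` {s}"
    "\<And>P. (\<And>u v. (u, v) \<in> r \<Longrightarrow> P {u, v}) \<Longrightarrow> \<forall>e \<in> path_edges w. P e"
    by (rule rtrancl_path) blast
  have wS: "set w \<subseteq> S" using w(5) s(1) by (auto simp: S_def)
  have wE: "path_edges w \<subseteq> E" using w(6)[of "\<lambda>e. e \<in> E"] by (auto simp: r_def)
  define p where "p = a # w @ [b]"
  obtain w' where w': "w = w' @ [t]" using w(2,4) by (metis append_butlast_last_id)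
  have "path_edges (w @ [b]) = path_edges w \<union> {{t, b}}"
    using path_edges_append[of w' t "[b]"] w' by auto
  then have pe: "path_edges p = insert {s, a} (insert {t, b} (path_edges w))"
    using w(2,3) by (cases w) (auto simp: p_def insert_commute)
  have pS: "f \<inter> S \<noteq> {}" if f: "f \<in> path_edges p" for f
  proof -
    from f consider "f = {s, a}" | "f = {t, b}" | "f \<in> path_edges w" using pe by auto
    then show ?thesis
    proof cases
      case 3
      then have "f \<subseteq> S" "f \<in> E" using path_edges_subset[of f w] wS wE by auto
      then show ?thesis using edge_card[of f] by (auto simp: card_2_iff)
    qed (use s t in auto)
  qed
  have pE: "path_edges p \<subseteq> E" using pe s t wE by auto
  show ?thesis
  proof (rule that[of p a b])
    show "distinct p" using w(1) wS ab by (auto simp: p_def)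
    show "hd p = a" "last p = b" "a \<noteq> b" using ab by (auto simp: p_def)
    show "set p \<inter> W = {a, b}" using ab AW wS S by (auto simp: p_def)
    show "path_edges p \<subseteq> E" by (rule pE)
    show "path_edges p \<inter> F = {}"
      using pS S is_cycle_Union[OF cyc(1)] by blast
    show "open_edge f \<subseteq> inside (img F)" if f: "f \<in> path_edges p" for f
    proof -
      obtain u where "u \<in> f" "u \<in> S" using pS[OF f] by auto
      then show ?thesis using pos_inside_imp_open_edge[OF cyc, of f u] S f pE by auto
    qed
  qed
qed

text \<open>In terms of faces, this is Euler's formula when every inner face other than a triangle
  has length at least 6; \<open>card F\<close> accounts for the boundary, which has a face on one
  side only. Splitting loses nothing: a path with k edges and k + 1 vertices adds 4 k + 2 k + 6 on
  the left and 6 (k + 1) on the right.\<close>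

lemma enclosed_count:
  assumes "inseparable V E" "\<not> contains_cycle E 4" "\<not> contains_cycle E 5"
    and "is_cycle W F" "F \<subseteq> E"
  shows "4 * card (enclosed_edges F) + card F + 6
    \<le> 6 * card (enclosed_vertices F) + 3 * card (triangles (enclosed_edges F))"
  using assms(4,5)
proof (induction "card (enclosed_edges F)" arbitrary: W F rule: less_induct)
  case less
  have finE: "finite (enclosed_edges F)" for F using finite_E by (simp add: enclosed_edges_def)
  have finV: "finite (enclosed_vertices F)" for F using finite_V by (simp add: enclosed_vertices_def)
  have finU: "finite (\<Union> (enclosed_edges F))" for F
    using finite_V edge_subset by (auto simp: enclosed_edges_def intro: finite_subset)
  show ?case
  proof (cases "enclosed_edges F = F")
    case True
    have "W \<subseteq> enclosed_vertices F"
      using is_cycle_Union[OF less(2)] less(3) edge_subset by (auto simp: enclosed_vertices_def)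
    then have V: "card W \<le> card (enclosed_vertices F)" using finV card_mono by blast
    have WF: "card F = card W" "3 \<le> card W"
      using is_cycle_card is_cycle_card_ge less(2) by auto
    have "contains_cycle E (card W)" using is_cycle_contains[OF less(2,3)] .
    then have n: "card W \<noteq> 4" "card W \<noteq> 5" using assms(2,3) by metis+
    \<comment> \<open>With nothing inside, a triangle gives 21 on both sides, and a longer cycle
      needs \<open>5 * card W + 6 \<le> 6 * card W\<close>, that is, length at least 6.\<close>
    show ?thesis
    proof (cases "card W = 3")
      case True
      have "triangles F \<noteq> {}" using is_cycle_triangle[OF less(2) True] by auto
      then have "1 \<le> card (triangles F)"
        using finite_triangles[of F] finU[of F] \<open>enclosed_edges F = F\<close>
        by (simp add: Suc_le_eq card_gt_0_iff)
      then show ?thesis using V WF True \<open>enclosed_edges F = F\<close> by simp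
    next
      case False
      then have "6 \<le> card W" using n WF(2) by auto
      then show ?thesis using V WF \<open>enclosed_edges F = F\<close> by simp
    qed
  next
    case False
    then obtain e where "e \<in> enclosed_edges F" "e \<notin> F"
      using less(3) by (auto simp: enclosed_edges_def)
    then obtain p a b where p: "distinct p" "hd p = a" "last p = b" "a \<noteq> b" "set p \<inter> W = {a, b}"
      "path_edges p \<subseteq> E" "path_edges p \<inter> F = {}"
      "\<And>e. e \<in> path_edges p \<Longrightarrow> open_edge e \<subseteq> inside (img F)"
      using enclosed_path[OF less(2,3) assms(1)] by metis
    obtain W1 F1 W2 F2 where s: "is_cycle W1 F1" "F1 \<subseteq> E" "is_cycle W2 F2" "F2 \<subseteq> E"
      "enclosed_edges F1 \<union> enclosed_edges F2 = enclosed_edges F"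
      "enclosed_edges F1 \<inter> enclosed_edges F2 = path_edges p"
      "enclosed_vertices F1 \<union> enclosed_vertices F2 = enclosed_vertices F"
      "enclosed_vertices F1 \<inter> enclosed_vertices F2 = set p"
      "card F1 + card F2 = card F + 2 * card (path_edges p)"
      "enclosed_edges F1 \<subset> enclosed_edges F" "enclosed_edges F2 \<subset> enclosed_edges F"
      using split_cycle[OF less(2,3) p] by metis
    have 1: "4 * card (enclosed_edges F1) + card F1 + 6
      \<le> 6 * card (enclosed_vertices F1) + 3 * card (triangles (enclosed_edges F1))"
      using less(1)[OF _ s(1,2)] psubset_card_mono[OF finE s(10)] by simp
    have 2: "4 * card (enclosed_edges F2) + card F2 + 6
      \<le> 6 * card (enclosed_vertices F2) + 3 * card (triangles (enclosed_edges F2))"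
      using less(1)[OF _ s(3,4)] psubset_card_mono[OF finE s(11)] by simp
    have 3: "card (enclosed_edges F1) + card (enclosed_edges F2)
        = card (enclosed_edges F) + card (path_edges p)"
      using card_Un_Int[OF finE finE] s(5,6) by metis
    have "card (enclosed_vertices F1) + card (enclosed_vertices F2)
        = card (enclosed_vertices F) + card (set p)"
      using card_Un_Int[OF finV finV] s(7,8) by metis
    moreover have "card (set p) = Suc (card (path_edges p))"
    proof -
      have "p \<noteq> []" using p(5) by auto
      then show ?thesis using card_path_edges[of p] distinct_card[OF p(1)] p(1) by simp
    qed
    ultimately have 4: "card (enclosed_vertices F1) + card (enclosed_vertices F2)
        = card (enclosed_vertices F) + card (path_edges p) + 1" by simp
    have "triangles (enclosed_edges F1 \<inter> enclosed_edges F2) = {}"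
      unfolding s(6) by (rule triangles_path_edges[OF p(1)])
    then have 5: "card (triangles (enclosed_edges F1)) + card (triangles (enclosed_edges F2))
        \<le> card (triangles (enclosed_edges F))"
      using card_triangles_disjoint[OF finU] s(10,11) by (metis psubset_imp_subset)
    show ?thesis using 1 2 3 4 5 s(9) by linarith
  qed
qed

text \<open>If an edge \<open>{a, b}\<close> were a bridge, the separations at \<open>b\<close> and
  at \<open>a\<close> would leave no vertices but these two. So some path from \<open>a\<close> to
  \<open>b\<close> avoids the edge, which closes it to a cycle.\<close>

lemma exists_cycle:
  assumes insep: "inseparable V E" and "3 \<le> card V" and "E \<noteq> {}"
  obtains W F where "is_cycle W F" "F \<subseteq> E"
proof -
  obtain e where e: "e \<in> E" using assms by auto
  then obtain a b where ab: "e = {a, b}" "a \<noteq> b" using edge_card[OF e] by (auto simp: card_2_iff)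
  have abV: "a \<in> V" "b \<in> V" using edge_subset e ab by auto
  define r where "r = {(u, v). {u, v} \<in> E - {e}}"
  define S where "S = r\<^sup>* `` {a}"
  have "b \<in> S"
  proof (rule ccontr)
    assume b: "b \<notin> S"
    have SV: "s \<in> V" if "s \<in> S" for s
    proof -
      have "(a, s) \<in> r\<^sup>*" using that by (simp add: S_def)
      then show ?thesis by (induction) (use abV edge_subset in \<open>auto simp: r_def\<close>)
    qed
    have aS: "a \<in> S" by (simp add: S_def)
    have edges: "f \<subseteq> S \<or> f \<subseteq> V - S" if f: "f \<in> E" "f \<noteq> e" for f
    proof -
      obtain u v where uv: "f = {u, v}" using edge_card[OF f(1)] by (auto simp: card_2_iff)
      then have "(u, v) \<in> r" "(v, u) \<in> r" using f by (auto simp: r_def insert_commute)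
      then have "u \<in> S \<longleftrightarrow> v \<in> S" by (auto simp: S_def intro: rtrancl_into_rtrancl)
      then show ?thesis using uv edge_subset[OF f(1)] by auto
    qed
    have "insert b S = V \<or> V - S = V"
    proof -
      have "insert b S \<union> (V - S) = V" using SV abV by auto
      moreover have "insert b S \<inter> (V - S) = {b}" using b abV by auto
      moreover have "\<forall>f\<in>E. f \<subseteq> insert b S \<or> f \<subseteq> V - S" using edges ab aS by blast
      ultimately show ?thesis using insep unfolding inseparable_def
        by (metis is_singletonI is_singleton_altdef order_refl)
    qed
    then have V1: "insert b S = V" using aS abV by auto
    have "S = V \<or> insert a (V - S) = V"
    proof -
      have "S \<union> insert a (V - S) = V" using SV abV by auto
      moreover have "S \<inter> insert a (V - S) = {a}" using aS by auto
      moreover have "\<forall>f\<in>E. f \<subseteq> S \<or> f \<subseteq> insert a (V - S)" using edges ab abV b by blast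
      ultimately show ?thesis using insep unfolding inseparable_def
        by (metis is_singletonI is_singleton_altdef order_refl)
    qed
    then have "insert a (V - S) = V" using b abV by auto
    then have "V = {a, b}" using V1 b abV by auto
    then show False using assms(2) ab by simp
  qed
  then have "(a, b) \<in> r\<^sup>*" by (simp add: S_def)
  then obtain w where w: "distinct w" "w \<noteq> []" "hd w = a" "last w = b"
    "\<And>P. (\<And>u v. (u, v) \<in> r \<Longrightarrow> P {u, v}) \<Longrightarrow> \<forall>e \<in> path_edges w. P e"
    by (rule rtrancl_path) blast
  have wE: "path_edges w \<subseteq> E - {e}" using w(5)[of "\<lambda>f. f \<in> E - {e}"] by (auto simp: r_def)
  obtain w' where w': "w = w' @ [b]" using w(2,4) by (metis append_butlast_last_id)
  then obtain xs where xs: "w = a # xs @ [b]" using w(3) ab by (cases w') auto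
  have "xs \<noteq> []" using xs wE ab by auto
  then have "is_cycle (set (a # xs @ b # [])) (path_edges (a # xs @ [b]) \<union> path_edges (b # [] @ [a]))"
    using w(1) xs by (intro is_cycleI) auto
  moreover have "path_edges (a # xs @ [b]) \<union> path_edges (b # [] @ [a]) \<subseteq> E"
    using wE xs e ab by (auto simp: insert_commute)
  ultimately show ?thesis using that by blast
qed

text \<open>A cycle with the fewest enclosed edges cannot be split any further.\<close>

lemma exists_facial_cycle:
  assumes "inseparable V E" and "3 \<le> card V" and "E \<noteq> {}"
  obtains W F where "is_cycle W F" "F \<subseteq> E" "enclosed_edges F = F"
proof -
  define Q where "Q = (\<lambda>F. (\<exists>W. is_cycle W F) \<and> F \<subseteq> E)"
  have "\<exists>F. Q F" using exists_cycle[OF assms] unfolding Q_def by metis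
  then obtain F where F: "Q F" and min: "\<And>F'. Q F' \<Longrightarrow> card (enclosed_edges F) \<le> card (enclosed_edges F')"
    using ex_has_least_nat[of Q _ "\<lambda>F. card (enclosed_edges F)"] by blast
  then obtain W where cyc: "is_cycle W F" "F \<subseteq> E" by (auto simp: Q_def)
  have "enclosed_edges F = F"
  proof (rule ccontr)
    assume "enclosed_edges F \<noteq> F"
    then obtain e where "e \<in> enclosed_edges F" "e \<notin> F"
      using cyc(2) by (auto simp: enclosed_edges_def)
    then obtain p a b where p: "distinct p" "hd p = a" "last p = b" "a \<noteq> b" "set p \<inter> W = {a, b}"
      "path_edges p \<subseteq> E" "path_edges p \<inter> F = {}"
      "\<And>e. e \<in> path_edges p \<Longrightarrow> open_edge e \<subseteq> inside (img F)"
      using enclosed_path[OF cyc assms(1)] by metis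
    obtain W1 F1 where "is_cycle W1 F1" "F1 \<subseteq> E" "enclosed_edges F1 \<subset> enclosed_edges F"
      using split_cycle[OF cyc p] by metis
    moreover have "finite (enclosed_edges F)" using finite_E by (simp add: enclosed_edges_def)
    ultimately show False
      using min[of F1] psubset_card_mono[of "enclosed_edges F" "enclosed_edges F1"] by (auto simp: Q_def)
  qed
  then show ?thesis using that cyc by blast
qed

end

section \<open>Passing to subgraphs\<close>

lemma planar_subgraph:
  assumes "planar V E" "V' \<subseteq> V" "E' \<subseteq> E" "\<And>e. e \<in> E' \<Longrightarrow> e \<subseteq> V'"
  shows "planar V' E'"
proof -
  obtain pos \<gamma> where d: "planar_drawing V E pos \<gamma>" using assms(1) by (auto simp: planar_def)
  have e: "arc (\<gamma> e)" "{pathstart (\<gamma> e), pathfinish (\<gamma> e)} = pos ` e"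
    "path_image (\<gamma> e) \<inter> pos ` V = pos ` e" if "e \<in> E'" for e
    using d that assms(3) unfolding planar_drawing_def by (metis subsetD)+
  have ee: "path_image (\<gamma> e) \<inter> path_image (\<gamma> e') = pos ` (e \<inter> e')"
    if "e \<in> E'" "e' \<in> E'" "e \<noteq> e'" for e e'
    using d that assms(3) unfolding planar_drawing_def by (metis subsetD)
  have int: "path_image (\<gamma> e) \<inter> pos ` V' = pos ` e" if "e \<in> E'" for e
    using e(3)[OF that] assms(2) assms(4)[OF that] by blast
  have inj: "inj_on pos V'"
    using d assms(2) inj_on_subset unfolding planar_drawing_def by metis
  have "planar_drawing V' E' pos \<gamma>"
    unfolding planar_drawing_def
  proof (intro conjI ballI impI)
    show "inj_on pos V'" by (rule inj)
  qed (rule e(1) e(2) int ee; assumption)+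
  then show ?thesis unfolding planar_def by blast
qed

lemma simple_graph_subgraph:
  "simple_graph V E \<Longrightarrow> V' \<subseteq> V \<Longrightarrow> E' \<subseteq> E \<Longrightarrow> (\<And>e. e \<in> E' \<Longrightarrow> e \<subseteq> V') \<Longrightarrow> simple_graph V' E'"
  unfolding simple_graph_def using finite_subset by fastforce

lemma contains_cycle_mono: "contains_cycle E k \<Longrightarrow> E \<subseteq> E' \<Longrightarrow> contains_cycle E' k"
  unfolding contains_cycle_def by blast

context drawn_graph
begin

text \<open>Inversion in a point inside a facial cycle puts the whole drawing on the inner side of it.\<close>

lemma invert_drawing:
  assumes cyc: "is_cycle W F" "F \<subseteq> E" and facial: "enclosed_edges F = F"
  obtains pos' \<gamma>' where "drawn_graph V E pos' \<gamma>'" "drawn_graph.enclosed_edges E pos' \<gamma>' F = E"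
proof -
  define K where "K = img F"
  have K: "open (inside K)" "connected (inside K)" "connected (outside K)" "inside K \<noteq> {}"
    using open_inside_cycle connected_inside_cycle connected_outside_cycle inside_cycle_nonempty cyc
    by (auto simp: K_def)
  have "\<not> inside K \<subseteq> pos ` V"
    using K finite_V finite_imp_not_open finite_subset by blast
  then obtain z where z: "z \<in> inside K" "z \<notin> pos ` V" by auto
  have out: "open_edge e \<subseteq> outside K" if e: "e \<in> E" "e \<notin> F" for e
  proof -
    have "\<not> open_edge e \<subseteq> inside (img F)" using facial e by (auto simp: enclosed_edges_def)
    then have "open_edge e \<inter> inside K = {}" using open_edge_side[OF cyc e] by (auto simp: K_def)
    moreover have "open_edge e \<inter> K = {}" using open_edge_Int_img[OF e(1) cyc(2) e(2)] K_def by simp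
    ultimately show ?thesis using inside_Un_outside[of K] by blast
  qed
  have z_edge: "z \<notin> path_image (\<gamma> e)" if e: "e \<in> E" for e
  proof (cases "e \<in> F")
    case True
    have "path_image (\<gamma> e) \<subseteq> K" using True by (auto simp: K_def img_def)
    then show ?thesis using z(1) inside_no_overlap by blast
  next
    case False
    have "z \<notin> open_edge e" using out[OF e False] z(1) inside_Int_outside[of K] by blast
    then show ?thesis using z(2) edge_subset[OF e] by (auto simp: open_edge_def)
  qed
  \<comment> \<open>As \<open>inverse 0 = 0\<close>, \<open>f\<close> is injective on the whole
    plane, with \<open>f z = 0\<close>; only its continuity requires that \<open>z\<close> be
    avoided.\<close>
  define f where "f = (\<lambda>w. inverse (w - z))"
  have inj: "inj f" by (auto simp: f_def inj_on_def)
  have cont: "continuous_on S f" if "z \<notin> S" for S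
    unfolding f_def using that by (intro continuous_intros) auto
  define pos' \<gamma>' where "pos' = f \<circ> pos" and "\<gamma>' = (\<lambda>e. f \<circ> \<gamma> e)"
  have image: "path_image (\<gamma>' e) = f ` path_image (\<gamma> e)" for e
    by (simp add: \<gamma>'_def path_image_compose)
  have pos': "pos' ` S = f ` pos ` S" for S by (simp add: pos'_def image_comp)
  have "planar_drawing V E pos' \<gamma>'"
    unfolding planar_drawing_def
  proof (intro conjI ballI impI)
    show "inj_on pos' V" using inj_pos inj by (auto simp: pos'_def inj_on_def)
    fix e assume e: "e \<in> E"
    have "path (\<gamma>' e)" unfolding \<gamma>'_def
      using path_continuous_image[of "\<gamma> e" f] cont[OF z_edge[OF e]] arc_edge[OF e] arc_imp_path by blast
    then show "arc (\<gamma>' e)" using arc_edge[OF e] inj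
      by (auto simp: arc_def \<gamma>'_def inj_on_def)
    have "{pathstart (\<gamma>' e), pathfinish (\<gamma>' e)} = f ` {pathstart (\<gamma> e), pathfinish (\<gamma> e)}"
      by (simp add: \<gamma>'_def pathstart_compose pathfinish_compose)
    then show "{pathstart (\<gamma>' e), pathfinish (\<gamma>' e)} = pos' ` e"
      using ends_edge[OF e] pos' by simp
    show "path_image (\<gamma>' e) \<inter> pos' ` V = pos' ` e"
      unfolding image pos' image_Int[OF inj, symmetric] edge_Int_V[OF e] ..
    fix e' assume e': "e' \<in> E" "e \<noteq> e'"
    show "path_image (\<gamma>' e) \<inter> path_image (\<gamma>' e') = pos' ` (e \<inter> e')"
      unfolding image pos' image_Int[OF inj, symmetric] edge_Int_edge[OF e e'] ..
  qed
  then interpret D': drawn_graph V E pos' \<gamma>'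
    using simple by unfold_locales auto
  define K' where "K' = f ` K"
  have imgK': "D'.img F = K'"
    by (auto simp: K'_def K_def D'.img_def img_def image)
  have K': "open (inside K')" "open (outside K')" "inside K' \<noteq> {}" "bounded (inside K')"
    using D'.open_inside_cycle[OF cyc] D'.open_outside_cycle[OF cyc]
      D'.inside_cycle_nonempty[OF cyc] D'.bounded_inside_cycle[OF cyc] imgK' by auto
  have side: "f ` S \<subseteq> inside K' \<or> f ` S \<subseteq> outside K'" if "connected S" "S \<inter> K = {}" "z \<notin> S" for S
  proof -
    have "connected (f ` S)" using that cont connected_continuous_image by blast
    moreover have "f ` S \<inter> K' = {}"
      unfolding K'_def image_Int[OF inj, symmetric] that(2) by simp
    then have sub: "f ` S \<subseteq> inside K' \<union> outside K'" using inside_Un_outside[of K'] by blast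
    ultimately have "inside K' \<inter> f ` S = {} \<or> outside K' \<inter> f ` S = {}"
      using K'(1,2) inside_Int_outside[of K'] by (intro connectedD) auto
    then show ?thesis using sub by blast
  qed
  have "f ` (inside K - {z}) \<subseteq> outside K'"
  proof -
    have "connected (inside K - {z})" using K by (intro connected_open_delete) auto
    moreover have "(inside K - {z}) \<inter> K = {}" using inside_no_overlap[of K] by blast
    \<comment> \<open>Points close to \<open>z\<close> are sent arbitrarily far away, whereas the
      inside of \<open>K'\<close> is bounded; so the punctured inside must go to the
      outside.\<close>
    moreover have "\<not> bounded (f ` (inside K - {z}))"
    proof
      assume "bounded (f ` (inside K - {z}))"
      then obtain B where B: "B > 0" "\<And>w. w \<in> inside K - {z} \<Longrightarrow> norm (f w) \<le> B"
        unfolding bounded_pos by auto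
      obtain \<epsilon> where \<epsilon>: "\<epsilon> > 0" "ball z \<epsilon> \<subseteq> inside K" using K(1) z(1) by (meson openE)
      define t where "t = min (\<epsilon> / 2) (1 / (2 * B))"
      have t: "0 < t" "t < \<epsilon>" "t \<le> 1 / (2 * B)" using \<epsilon> B by (auto simp: t_def)
      have "z + of_real t \<in> inside K - {z}" using \<epsilon>(2) t by (auto simp: dist_norm)
      then have "inverse t \<le> B" using B(2) t by (fastforce simp: f_def norm_inverse)
      then have "1 \<le> B * t" using t by (simp add: field_simps)
      also have "B * t \<le> B * (1 / (2 * B))" using t(3) B(1) by (intro mult_left_mono) auto
      also have "\<dots> = 1 / 2" using B(1) by simp
      finally show False by simp
    qed
    ultimately show ?thesis using side[of "inside K - {z}"] K'(4) bounded_subset by blast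
  qed
  moreover have "\<not> f ` outside K \<subseteq> outside K'"
  proof
    assume o: "f ` outside K \<subseteq> outside K'"
    \<comment> \<open>Every nonzero value is taken by \<open>f\<close>, and under the assumption no
      point other than \<open>z\<close> is sent into the inside of \<open>K'\<close>. Only 0, the
      image of infinity, would remain, but the inside is open and nonempty.\<close>
    have "inside K' \<subseteq> {0}"
    proof (rule ccontr)
      assume "\<not> inside K' \<subseteq> {0}"
      then obtain y where y: "y \<in> inside K'" "y \<noteq> 0" by auto
      define x where "x = z + inverse y"
      have fx: "f x = y" by (simp add: f_def x_def)
      have "x \<noteq> z" using y(2) by (simp add: x_def)
      have "y \<notin> K'" using y(1) inside_no_overlap by blast
      then have "x \<notin> K" using fx by (auto simp: K'_def)
      then have "x \<in> inside K - {z} \<or> x \<in> outside K" using \<open>x \<noteq> z\<close> inside_Un_outside[of K] by blast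
      then have "y \<in> outside K'" using calculation o fx by blast
      then show False using y(1) inside_Int_outside[of K'] by blast
    qed
    then show False using K' finite_imp_not_open finite_subset by blast
  qed
  ultimately have "f ` outside K \<subseteq> inside K'"
    using side[of "outside K"] K(3) z(1) outside_no_overlap[of K] inside_Int_outside[of K] by blast
  moreover have "D'.open_edge e = f ` open_edge e" for e
    unfolding D'.open_edge_def open_edge_def image pos' using inj by (simp add: image_set_diff)
  ultimately have "D'.open_edge e \<subseteq> inside K'" if "e \<in> E" "e \<notin> F" for e
    using out[OF that] that by (metis image_mono order_trans)
  then have "D'.enclosed_edges F = E" by (auto simp: D'.enclosed_edges_def imgK')
  then show ?thesis using that D'.drawn_graph_axioms by blast
qed

end

text \<open>A separation of order at most one yields two smaller graphs whose bounds add up: the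
  second constant 6 pays for the vertex counted twice. An inseparable graph with at least three
  vertices and an edge has a facial cycle; after inversion this cycle encloses the whole
  graph.\<close>

lemma planar_edge_bound:
  assumes "simple_graph V E" "planar V E" "\<not> contains_cycle E 4" "\<not> contains_cycle E 5" "V \<noteq> {}"
  shows "4 * card E + 6 \<le> 6 * card V + 3 * card (triangles E)"
  using assms
proof (induction "card V" arbitrary: V E rule: less_induct)
  case less
  have finV: "finite V" and eV: "\<And>e. e \<in> E \<Longrightarrow> e \<subseteq> V" and e2: "\<And>e. e \<in> E \<Longrightarrow> card e = 2"
    using less(2) by (auto simp: simple_graph_def)
  have finE: "finite E" using finV eV by (meson Pow_iff finite_Pow_iff finite_subset subsetI)
  have V1: "1 \<le> card V" using finV less(6) by (simp add: Suc_le_eq card_gt_0_iff)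
  show ?case
  proof (cases "inseparable V E")
    case True
    consider "E = {}" | "card V \<le> 2" "E \<noteq> {}" | "3 \<le> card V" "E \<noteq> {}" by linarith
    then show ?thesis
    proof cases
      case 1
      then show ?thesis using V1 by simp
    next
      case 2
      have "e = V" if "e \<in> E" for e
        using card_subset_eq[OF finV eV[OF that]] e2[OF that] 2(1) card_mono[OF finV eV[OF that]] by simp
      then have "E = {V}" using 2(2) by auto
      moreover have "card V = 2" using e2[of V] calculation by simp
      ultimately show ?thesis by simp
    next
      case 3
      obtain pos \<gamma> where "planar_drawing V E pos \<gamma>" using less(3) by (auto simp: planar_def)
      then interpret drawn_graph V E pos \<gamma> using less(2) by unfold_locales
      obtain W F where cyc: "is_cycle W F" "F \<subseteq> E" "enclosed_edges F = F"
        using exists_facial_cycle[OF True 3] .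
      obtain pos' \<gamma>' where d: "drawn_graph V E pos' \<gamma>'" "drawn_graph.enclosed_edges E pos' \<gamma>' F = E"
        using invert_drawing[OF cyc] .
      then interpret D': drawn_graph V E pos' \<gamma>' by simp
      have "4 * card E + card F + 6 \<le> 6 * card (D'.enclosed_vertices F) + 3 * card (triangles E)"
        using D'.enclosed_count[OF True less(4,5) cyc(1,2)] d(2) by simp
      moreover have "card (D'.enclosed_vertices F) \<le> card V"
        by (intro card_mono finV) (auto simp: D'.enclosed_vertices_def)
      ultimately show ?thesis by linarith
    qed
  next
    case False
    then obtain A B where AB: "A \<union> B = V" "card (A \<inter> B) \<le> 1" "\<forall>e\<in>E. e \<subseteq> A \<or> e \<subseteq> B"
      "A \<noteq> V" "B \<noteq> V" unfolding inseparable_def by blast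
    define EA EB where "EA = {e \<in> E. e \<subseteq> A}" and "EB = {e \<in> E. e \<subseteq> B}"
    have bound: "4 * card E' + 6 \<le> 6 * card V' + 3 * card (triangles E')"
      if "V' \<subset> V" "V' \<noteq> {}" "E' = {e \<in> E. e \<subseteq> V'}" for V' E'
    proof (rule less(1))
      show "card V' < card V" using that finV psubset_card_mono by blast
      have sub: "V' \<subseteq> V" "E' \<subseteq> E" "\<And>e. e \<in> E' \<Longrightarrow> e \<subseteq> V'" using that by auto
      show "simple_graph V' E'" by (rule simple_graph_subgraph[OF less(2) sub])
      show "planar V' E'" by (rule planar_subgraph[OF less(3) sub])
      show "\<not> contains_cycle E' 4" "\<not> contains_cycle E' 5"
        using contains_cycle_mono[OF _ sub(2)] less(4,5) by metis+
    qed (use that in auto)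
    have A: "4 * card EA + 6 \<le> 6 * card A + 3 * card (triangles EA)"
      using bound[of A EA] AB EA_def by auto
    have B: "4 * card EB + 6 \<le> 6 * card B + 3 * card (triangles EB)"
      using bound[of B EB] AB EB_def by auto
    have fin: "finite A" "finite B" using AB(1) finV by auto
    have "EA \<inter> EB = {}"
    proof (rule ccontr)
      assume "EA \<inter> EB \<noteq> {}"
      then obtain e where "e \<in> E" "e \<subseteq> A \<inter> B" by (auto simp: EA_def EB_def)
      then have "2 \<le> card (A \<inter> B)" using e2[of e] card_mono[of "A \<inter> B" e] fin by simp
      then show False using AB(2) by simp
    qed
    moreover have EAB: "EA \<union> EB = E" using AB(3) by (auto simp: EA_def EB_def)
    ultimately have "card E = card EA + card EB"
      using finE card_Un_disjoint[of EA EB] by auto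
    moreover have "card A + card B \<le> card V + 1"
      using card_Un_Int[OF fin] AB(1,2) by simp
    moreover have "card (triangles EA) + card (triangles EB) \<le> card (triangles E)"
    proof (rule card_triangles_disjoint)
      show "finite (\<Union> E)" using finV eV by (meson Union_least finite_subset)
      have "triangles {} = {}"
        unfolding triangles_def by (auto simp: card_3_iff) (metis card_2_iff insertCI subset_insertI)
      then show "triangles (EA \<inter> EB) = {}" using \<open>EA \<inter> EB = {}\<close> by simp
    qed (use EAB in auto)
    ultimately show ?thesis using A B by linarith
  qed
qed

section \<open>Discharging\<close>

definition nbrs :: "'a set set \<Rightarrow> 'a \<Rightarrow> 'a set" where
  "nbrs E v = {u. {u, v} \<in> E}"

lemma nbrs_sym: "u \<in> nbrs E v \<longleftrightarrow> v \<in> nbrs E u"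
  by (simp add: nbrs_def insert_commute)

lemma nbrs_irrefl: "simple_graph V E \<Longrightarrow> v \<notin> nbrs E v"
  by (auto simp: nbrs_def simple_graph_def)

lemma nbrs_subset: "simple_graph V E \<Longrightarrow> nbrs E v \<subseteq> V"
  by (auto simp: nbrs_def simple_graph_def)

lemma finite_nbrs: "simple_graph V E \<Longrightarrow> finite (nbrs E v)"
  using nbrs_subset finite_subset unfolding simple_graph_def by metis

lemma card_nbrs:
  assumes "simple_graph V E"
  shows "card (nbrs E v) = vertex_degree E v"
proof -
  have "{e \<in> E. v \<in> e} = (\<lambda>u. {u, v}) ` nbrs E v"
  proof (intro equalityI subsetI)
    fix e assume e: "e \<in> {e \<in> E. v \<in> e}"
    then have "card e = 2" using assms by (auto simp: simple_graph_def)
    then obtain x y where "e = {x, y}" by (auto simp: card_2_iff)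
    then have "\<exists>u. e = {u, v}" using e by auto
    then show "e \<in> (\<lambda>u. {u, v}) ` nbrs E v" using e by (auto simp: nbrs_def)
  qed (auto simp: nbrs_def)
  moreover have "inj_on (\<lambda>u. {u, v}) (nbrs E v)" by (auto simp: inj_on_def doubleton_eq_iff)
  ultimately show ?thesis by (simp add: vertex_degree_def card_image)
qed

lemma handshake:
  assumes "simple_graph V E"
  shows "(\<Sum>v\<in>V. card (nbrs E v)) = 2 * card E"
proof -
  have fin: "finite V" "finite E" and e: "\<And>e. e \<in> E \<Longrightarrow> e \<subseteq> V \<and> card e = 2"
    using assms finite_subset[of E "Pow V"] by (auto simp: simple_graph_def)
  have "{v \<in> V. v \<in> e} = e" if "e \<in> E" for e using e[OF that] by auto
  then have "(\<Sum>v\<in>V. card {e \<in> E. v \<in> e}) = 2 * card E"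
    using fin e by (intro sum_multicount) auto
  then show ?thesis using card_nbrs[OF assms] by (simp add: vertex_degree_def)
qed

lemma common_nbr_unique:
  assumes "simple_graph V E" "\<not> contains_cycle E 4" "u \<noteq> v"
    and "x \<in> nbrs E u" "x \<in> nbrs E v" "y \<in> nbrs E u" "y \<in> nbrs E v"
  shows "x = y"
proof (rule ccontr)
  assume "x \<noteq> y"
  then have d: "distinct [u, x, v, y]"
    using assms nbrs_irrefl[OF assms(1)] by auto
  have e: "{u, x} \<in> E" "{x, v} \<in> E" "{v, y} \<in> E" "{y, u} \<in> E"
    using assms(4-7) by (simp_all add: nbrs_def insert_commute)
  have "{[u, x, v, y] ! i, [u, x, v, y] ! (Suc i mod 4)} \<in> E" if "i < 4" for i
  proof -
    from that consider "i = 0" | "i = 1" | "i = 2" | "i = 3" by linarith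
    then show ?thesis using e by cases simp_all
  qed
  then have "contains_cycle E 4"
    unfolding contains_cycle_def using d by (intro conjI exI[of _ "[u, x, v, y]"]) auto
  then show False using assms(2) by simp
qed

lemma triangle_nbrs: "t \<in> triangles E \<Longrightarrow> u \<in> t \<Longrightarrow> v \<in> t \<Longrightarrow> u \<noteq> v \<Longrightarrow> u \<in> nbrs E v"
  unfolding triangles_def nbrs_def by (auto simp: card_insert_if)

text \<open>The third corners of two triangles on an edge are common neighbours of its ends. So
  triangles are edge-disjoint, and charge sent along an edge has a unique triangle to go to.\<close>

lemma triangles_share_vertex:
  assumes "simple_graph V E" "\<not> contains_cycle E 4" "t \<in> triangles E" "t' \<in> triangles E"
    "u \<in> t" "u \<in> t'" "w \<in> t" "w \<in> t'" "u \<noteq> w"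
  shows "t = t'"
proof -
  have third: "\<exists>x. s = {u, w, x} \<and> x \<in> nbrs E u \<and> x \<in> nbrs E w"
    if s: "s \<in> triangles E" "u \<in> s" "w \<in> s" for s
  proof -
    have "card s = 3" using s by (simp add: triangles_def)
    then have "card (s - {u, w}) = 1" using s(2,3) assms(9) by (simp add: card_Diff_subset)
    then obtain x where x: "s - {u, w} = {x}" by (auto simp: card_1_singleton_iff)
    then have "x \<in> s" "x \<noteq> u" "x \<noteq> w" "s = {u, w, x}" using s(2,3) by auto
    then show ?thesis using triangle_nbrs[OF s(1)] s(2,3) by blast
  qed
  obtain x y where "t = {u, w, x}" "x \<in> nbrs E u" "x \<in> nbrs E w"
    "t' = {u, w, y}" "y \<in> nbrs E u" "y \<in> nbrs E w"
    using third[OF assms(3,5,7)] third[OF assms(4,6,8)] by metis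
  then show ?thesis using common_nbr_unique[OF assms(1,2,9)] by metis
qed

lemma triangles_subset_V: "simple_graph V E \<Longrightarrow> t \<in> triangles E \<Longrightarrow> t \<subseteq> V"
  using triangles_subset_Union[of t E] by (auto simp: simple_graph_def)

text \<open>Lower bound for what a vertex of degree \<open>a\<close> in a triangle whose other two degrees sum up
  to \<open>Y\<close> hands over to that triangle.\<close>

definition triangle_share :: "nat \<Rightarrow> nat \<Rightarrow> nat \<Rightarrow> real \<Rightarrow> bool" where
  "triangle_share M Y a v \<longleftrightarrow> 2 \<le> a \<and> a \<le> M \<and>
     (4 \<le> a \<longrightarrow> v \<ge> 4 - 12 / a) \<and>
     (a = 3 \<longrightarrow> v \<ge> - 3 / 16 \<and> (Y \<le> M + 2 \<longrightarrow> v \<ge> 0) \<and> (Y + 7 \<le> M \<longrightarrow> v \<ge> 3 / 2)) \<and>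
     (a = 2 \<longrightarrow> (\<exists>k::nat. v \<ge> - 2 + 3 / 4 * k \<and> M + 5 \<le> Y + k))"

section \<open>The three shares in a triangle add up to at least 3\<close>

lemma share_high_ge: "4 \<le> n \<Longrightarrow> n \<le> a \<Longrightarrow> 4 - 12 / real a \<ge> 4 - 12 / real n"
  by (simp add: frac_le)

text \<open>The estimate is tight for degrees 4, 4, 4. If a corner of degree 2 or 3 is short of
  charge, its condition on \<open>Y\<close> or \<open>k\<close> forces either a large
  \<open>a\<close>, whose share is close to 4, or many links. The case names give the degrees of the
  smaller corners, with h for at least 4 and l for all three being low.\<close>

lemma triangle_share_sum_sorted:
  assumes M: "32 \<le> M" and "c \<le> b" "b \<le> a"
    and A: "triangle_share M (b + c) a va" and B: "triangle_share M (a + c) b vb"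
    and C: "triangle_share M (a + b) c vc"
  shows "3 \<le> va + vb + vc"
proof -
  have bnd: "2 \<le> a" "a \<le> M" "2 \<le> b" "b \<le> M" "2 \<le> c" "c \<le> M"
    using A B C by (auto simp: triangle_share_def)
  have high: "v \<ge> 4 - 12 / real n" if "triangle_share M Y d v" "4 \<le> n" "n \<le> d" for Y d n v
  proof -
    have "v \<ge> 4 - 12 / real d" using that by (auto simp: triangle_share_def)
    then show ?thesis using order_trans[OF share_high_ge[OF that(2,3)]] by blast
  qed
  have high4: "v \<ge> 1" if "triangle_share M Y d v" "4 \<le> d" for Y d v
    using high[OF that(1), of 4] that(2) by simp
  note highA = high[OF A]
  have "c = 2 \<or> c = 3 \<or> 4 \<le> c" "b = 2 \<or> b = 3 \<or> 4 \<le> b" "a = 2 \<or> a = 3 \<or> 4 \<le> a"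
    using bnd by linarith+
  then consider (hhh) "4 \<le> c" | (h3) "c = 3" "4 \<le> b" | (h2) "c = 2" "4 \<le> b"
    | (33) "c = 3" "b = 3" "4 \<le> a" | (32) "c = 2" "b = 3" "4 \<le> a" | (22) "c = 2" "b = 2" "4 \<le> a"
    | (l3) "c = 3" "b = 3" "a = 3" | (l2) "c = 2" "b \<le> 3" "a \<le> 3"
    using assms(2,3) by (elim disjE) auto
  then show ?thesis
  proof cases
    case hhh
    then show ?thesis using high4[OF A] high4[OF B] high4[OF C] assms(2,3) by linarith
  next
    case h3
    have vc: "vc \<ge> - 3 / 16" "a + b + 7 \<le> M \<longrightarrow> vc \<ge> 3 / 2"
      using C h3 by (auto simp: triangle_share_def)
    show ?thesis
    proof (cases "12 \<le> a")
      case True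
      then have "va \<ge> 3" using highA[of 12] by simp
      then show ?thesis using high4[OF B] vc(1) h3 by simp
    next
      case False
      then have "vc \<ge> 3 / 2" using vc(2) assms(3) M by simp
      then show ?thesis using high4[OF A] high4[OF B] h3 assms(3) by simp
    qed
  next
    case h2
    obtain k :: nat where k: "vc \<ge> - 2 + 3 / 4 * k" "M + 5 \<le> a + b + k"
      using C h2 by (auto simp: triangle_share_def)
    have h: "4 \<le> a" "4 \<le> b" using h2 assms(3) by auto
    have v: "1 \<le> va" "1 \<le> vb" using high4[OF A] high4[OF B] h by auto
    show ?thesis
    proof (cases "4 \<le> k")
      case True
      then have "vc \<ge> 1" using k(1) by auto
      then show ?thesis using v by simp
    next
      case k3: False
      show ?thesis
      proof (cases "8 \<le> b")
        case True
        then have "va \<ge> 5 / 2" "vb \<ge> 5 / 2"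
          using highA[of 8] high[OF B, of 8] assms(3) by simp_all
        then show ?thesis using k(1) by simp
      next
        case False
        \<comment> \<open>From \<open>b \<le> 7\<close> and \<open>k \<le> 3\<close>: 27 = 32 + 5 -
          7 - 3.\<close>
        then have "27 \<le> a" using k(2) k3 M by linarith
        then have va: "va \<ge> 4 - 12 / 27" using highA[of 27] by simp
        show ?thesis
        proof (cases "5 \<le> b")
          case True
          then have "vb \<ge> 8 / 5" using high[OF B, of 5] by simp
          then show ?thesis using va k(1) by simp
        next
          case False
          then have "1 \<le> k" using k(2) h bnd by linarith
          then have "vc \<ge> - 5 / 4" using k(1) by simp
          then show ?thesis using va v by simp
        qed
      qed
    qed
  next
    case 33
    have v: "vb \<ge> - 3 / 16" "a + 3 \<le> M + 2 \<Longrightarrow> vb \<ge> 0" "a + 3 + 7 \<le> M \<Longrightarrow> vb \<ge> 3 / 2"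
      "vc \<ge> - 3 / 16" "a + 3 \<le> M + 2 \<Longrightarrow> vc \<ge> 0" "a + 3 + 7 \<le> M \<Longrightarrow> vc \<ge> 3 / 2"
      using B C 33 by (auto simp: triangle_share_def)
    consider "a \<le> 20" | "21 \<le> a" "a < M" | "a = M" using bnd by linarith
    then show ?thesis
    proof cases
      case 1
      then show ?thesis using high4[OF A] 33 v(3,6) M by simp
    next
      case 2
      then show ?thesis using highA[of 12] v(2,5) by simp
    next
      case 3
      then show ?thesis using highA[of 32] v(1,4) M by simp
    qed
  next
    case 32
    \<comment> \<open>Here \<open>Y\<close> is \<open>a + 2 \<le> M + 2\<close>, just within the
      range in which a corner of degree 3 owes nothing.\<close>
    have vb: "vb \<ge> 0" using B 32 bnd by (auto simp: triangle_share_def)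
    obtain k :: nat where k: "vc \<ge> - 2 + 3 / 4 * k" "M + 5 \<le> a + b + k"
      using C 32 unfolding triangle_share_def by blast
    show ?thesis
    proof (cases "6 \<le> k")
      case True
      then have "vc \<ge> 5 / 2" using k(1) by auto
      then show ?thesis using high4[OF A] 32 vb by simp
    next
      case k5: False
      show ?thesis
      proof (cases "a = M")
        case True
        then have "va \<ge> 4 - 12 / 32" "2 \<le> k" using highA[of 32] M k(2) 32 by simp_all
        then show ?thesis using vb k(1) by simp
      next
        case False
        then have "27 \<le> a" "3 \<le> k" using k(2) k5 M 32 bnd by linarith+
        moreover from this have "va \<ge> 4 - 12 / 27" using highA[of 27] by simp
        ultimately show ?thesis using vb k(1) by simp
      qed
    qed
  next
    case 22
    obtain k l :: nat where k: "vc \<ge> - 2 + 3 / 4 * k" "M + 5 \<le> a + b + k"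
      "vb \<ge> - 2 + 3 / 4 * l" "M + 5 \<le> a + c + l"
      using B C 22 unfolding triangle_share_def by blast
    show ?thesis
    proof (cases "a = M")
      case True
      then have "3 \<le> k" "3 \<le> l" using k(2,4) 22 by simp_all
      moreover have "va \<ge> 4 - 12 / 32" using highA[of 32] M True by simp
      ultimately show ?thesis using k(1,3) by simp
    next
      case False
      then have "4 \<le> k" "4 \<le> l" using k(2,4) 22 bnd by simp_all
      then show ?thesis using high4[OF A] 22 k(1,3) by simp
    qed
  next
    case l3
    then show ?thesis using A B C M by (auto simp: triangle_share_def)
  next
    case l2
    obtain k :: nat where k: "vc \<ge> - 2 + 3 / 4 * k" "M + 5 \<le> a + b + k"
      using C l2 by (auto simp: triangle_share_def)
    have "31 \<le> k" using k(2) l2 M by linarith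
    then have "vc \<ge> 20" using k(1) by auto
    moreover have "v \<ge> -2" if v: "triangle_share M Y d v" and d: "d \<le> 3" for Y d v
    proof (cases "d = 2")
      case True
      then obtain k :: nat where "v \<ge> - 2 + 3 / 4 * k" using v by (auto simp: triangle_share_def)
      moreover have "0 \<le> 3 / 4 * real k" by simp
      ultimately show ?thesis by linarith
    next
      case False
      then have "d = 3" using v d by (auto simp: triangle_share_def)
      then show ?thesis using v by (auto simp: triangle_share_def)
    qed
    note this[OF A] this[OF B]
    ultimately show ?thesis using l2 by simp
  qed
qed

lemma triangle_share_sum:
  assumes "32 \<le> M" "triangle_share M (b + c) a va" "triangle_share M (a + c) b vb"
    "triangle_share M (a + b) c vc"
  shows "3 \<le> va + vb + vc"
proof -
  have *: "triangle_share M (c + b) a va" "triangle_share M (c + a) b vb" "triangle_share M (b + a) c vc"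
    using assms by (simp_all add: add.commute)
  consider "c \<le> b" "b \<le> a" | "b \<le> c" "c \<le> a" | "c \<le> a" "a \<le> b" | "a \<le> c" "c \<le> b"
    | "a \<le> b" "b \<le> c" | "b \<le> a" "a \<le> c" by linarith
  then show ?thesis
  proof cases
    case 1 then show ?thesis using triangle_share_sum_sorted[of M c b a va vb vc] assms * by simp
  next
    case 2 then show ?thesis using triangle_share_sum_sorted[of M b c a va vc vb] assms * by simp
  next
    case 3 then show ?thesis using triangle_share_sum_sorted[of M c a b vb va vc] assms * by simp
  next
    case 4 then show ?thesis using triangle_share_sum_sorted[of M a c b vb vc va] assms * by simp
  next
    case 5 then show ?thesis using triangle_share_sum_sorted[of M a b c vc vb va] assms * by simp
  next
    case 6 then show ?thesis using triangle_share_sum_sorted[of M b a c vc va vb] assms * by simp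
  qed
qed

text \<open>
  \<open>\<kappa> v\<close> stands for the number of vertices that are close to \<open>v\<close> only through vertices outside \<open>T\<close>.
\<close>

locale stuck_graph =
  fixes T :: "'a set" and F :: "'a set set" and \<kappa> :: "'a \<Rightarrow> nat" and M :: nat
  assumes simple: "simple_graph T F" and no_C4: "\<not> contains_cycle F 4" and M: "32 \<le> M"
    and deg_le: "\<And>v. v \<in> T \<Longrightarrow> card (nbrs F v) \<le> M"
    and stuck: "\<And>v. v \<in> T \<Longrightarrow> card (nbrs F v) \<le> 3 \<Longrightarrow>
      M + 3 + (\<Sum>u\<in>nbrs F v. card (nbrs F u \<inter> nbrs F v)) \<le> (\<Sum>u\<in>nbrs F v. card (nbrs F u)) + \<kappa> v"
begin

section \<open>Charges and the rules for moving them\<close>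

abbreviation N where "N \<equiv> nbrs F"
abbreviation d where "d v \<equiv> card (N v)"

definition high where "high = {v \<in> T. 4 \<le> d v}"
definition low where "low = {v \<in> T. d v \<le> 3}"

text \<open>Along these edges charge goes to the neighbour itself; along its edges in a triangle a
  high vertex pays the triangle instead.\<close>

definition outer_nbrs where
  "outer_nbrs v = {u \<in> N v. \<not> (\<exists>t \<in> triangles F. u \<in> t \<and> v \<in> t)}"

text \<open>Vertices of degree 2 whose deficit cannot be settled jointly with the other corners of a
  triangle, so that they must be balanced on their own.\<close>

definition lonely where "lonely = {v \<in> T. d v = 2 \<and> (\<forall>t \<in> triangles F. v \<notin> t)}"

text \<open>The charge \<open>2 * d u - 6\<close> divided evenly among the \<open>d u\<close>
  edges.\<close>

definition c :: "'a \<Rightarrow> real" where "c u = 2 - 6 / d u"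

text \<open>
  \<open>flow u v\<close> is the charge passing from \<open>u\<close> to \<open>v\<close>. The part \<open>3 / 16\<close>, which degree-3 vertices pay to
  lonely ones, covers the deficit \<open>6 / M\<close> of a lonely vertex with one neighbour of degree 3 and
  one of degree \<open>M \<ge> 32\<close>.
\<close>

definition flow :: "'a \<Rightarrow> 'a \<Rightarrow> real" where
  "flow u v = (if u \<in> high then c u else 0) + (if v \<in> lonely \<and> d u = 3 then 3 / 16 else 0)
     - (if d v = 3 \<and> u \<in> lonely then 3 / 16 else 0)"

text \<open>The charge of a low vertex after all moves, where \<open>3 / 4\<close> per link comes
  from the outside vertices. High vertices need no counterpart: they only have to afford what they
  give.\<close>

definition \<psi> :: "'a \<Rightarrow> real" where
  "\<psi> v = 2 * real (d v) - 6 + 3 / 4 * \<kappa> v + (\<Sum>u\<in>outer_nbrs v. flow u v)"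

lemma finite_T: "finite T" using simple by (simp add: simple_graph_def)

lemma N_T: "u \<in> N v \<Longrightarrow> u \<in> T \<and> v \<in> T"
  using nbrs_subset[OF simple] nbrs_sym by (metis subsetD)

lemma N_irrefl: "v \<notin> N v" using nbrs_irrefl[OF simple] .

lemma finite_N [simp]: "finite (N v)" using finite_nbrs[OF simple] .

lemma triangle_T: "t \<in> triangles F \<Longrightarrow> t \<subseteq> T"
  using triangles_subset_V[OF simple] .

lemma finite_tri: "finite (triangles F)"
  by (rule finite_subset[of _ "Pow T"]) (use triangle_T finite_T in auto)

lemma triangle_card: "t \<in> triangles F \<Longrightarrow> card t = 3"
  by (simp add: triangles_def)

lemma finite_triangle: "t \<in> triangles F \<Longrightarrow> finite t"
  using triangle_card card.infinite by fastforce

lemma triangle_others: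
  assumes "t \<in> triangles F" "v \<in> t"
  obtains y z where "t = {v, y, z}" "v \<noteq> y" "v \<noteq> z" "y \<noteq> z" "y \<in> N v" "z \<in> N v" "y \<in> N z"
proof -
  have "card (t - {v}) = 2" using triangle_card[OF assms(1)] assms(2) by simp
  then obtain y z where yz: "t - {v} = {y, z}" "y \<noteq> z" by (auto simp: card_2_iff)
  then have "y \<in> t" "z \<in> t" "v \<noteq> y" "v \<noteq> z" "t = {v, y, z}" using assms(2) by auto
  then show ?thesis using that[of y z] yz(2) triangle_nbrs[OF assms(1)] assms(2) by metis
qed

text \<open>Triangles at \<open>v\<close> have only \<open>v\<close> in common, so each of them uses
  up two neighbours of its own.\<close>

lemma card_triangles_at:
  "card (outer_nbrs v) + 2 * card {t \<in> triangles F. v \<in> t} = d v"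
proof -
  let ?tri = "{t \<in> triangles F. v \<in> t}"
  have "card (\<Union>t\<in>?tri. t - {v}) = (\<Sum>t\<in>?tri. card (t - {v}))"
  proof (rule card_UN_disjoint)
    show "\<forall>i\<in>?tri. \<forall>j\<in>?tri. i \<noteq> j \<longrightarrow> (i - {v}) \<inter> (j - {v}) = {}"
      using triangles_share_vertex[OF simple no_C4] by blast
  qed (use finite_tri finite_triangle in auto)
  also have "\<dots> = (\<Sum>t\<in>?tri. 2)"
    using triangle_card by (intro sum.cong) auto
  finally have "card (\<Union>t\<in>?tri. t - {v}) = 2 * card ?tri" by simp
  moreover have "N v = outer_nbrs v \<union> (\<Union>t\<in>?tri. t - {v})"
    using triangle_nbrs[of _ F _ v] N_irrefl by (auto simp: outer_nbrs_def)
  moreover have "outer_nbrs v \<inter> (\<Union>t\<in>?tri. t - {v}) = {}" by (auto simp: outer_nbrs_def)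
  moreover have "finite (outer_nbrs v)" "finite (\<Union>t\<in>?tri. t - {v})"
    using finite_tri finite_triangle by (auto simp: outer_nbrs_def)
  ultimately show ?thesis using card_Un_disjoint[of "outer_nbrs v" "\<Union>t\<in>?tri. t - {v}"] by simp
qed

lemma outer_nbrs_sym: "u \<in> outer_nbrs v \<longleftrightarrow> v \<in> outer_nbrs u"
  using nbrs_sym[of u F v] by (auto simp: outer_nbrs_def)

lemma finite_outer [simp]: "finite (outer_nbrs v)" by (auto simp: outer_nbrs_def)

lemma c_ge: "u \<in> high \<Longrightarrow> 4 \<le> n \<Longrightarrow> n \<le> d u \<Longrightarrow> c u \<ge> 2 - 6 / real n"
  by (simp add: c_def frac_le)

lemma c_half: "u \<in> high \<Longrightarrow> c u \<ge> 1 / 2"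
  using c_ge[of u 4] by (simp add: high_def)

lemma flow_ge:
  "u \<in> high \<Longrightarrow> flow u v \<ge> c u"
  "flow u v \<ge> - 3 / 16"
  "d v \<noteq> 3 \<Longrightarrow> flow u v \<ge> 0"
  "d u \<noteq> 2 \<Longrightarrow> flow u v \<ge> 0"
  "v \<in> lonely \<Longrightarrow> d u = 3 \<Longrightarrow> flow u v \<ge> 3 / 16"
  using c_half[of u] by (auto simp: flow_def high_def lonely_def)

text \<open>No charge is created. The payments of \<open>3 / 16\<close> run between low vertices and
  cancel. A high vertex gives \<open>c u\<close> along outer edges to low vertices and
  \<open>2 * c u\<close> to each of its triangles, hence at most \<open>c u * d u\<close>, its own
  charge.\<close>

lemma total:
  "(\<Sum>v\<in>low. \<psi> v) + (\<Sum>t\<in>triangles F. \<Sum>u\<in>t \<inter> high. 2 * c u)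
    \<le> (\<Sum>v\<in>T. 2 * real (d v) - 6 + 3 / 4 * \<kappa> v)"
proof -
  have fin: "finite low" "finite high" using finite_T by (auto simp: low_def high_def)
  have T: "low \<union> high = T" "low \<inter> high = {}" by (auto simp: low_def high_def)
  have lonely_low: "lonely \<subseteq> low" by (auto simp: lonely_def low_def)
  have split: "(\<Sum>u\<in>outer_nbrs v. flow u v) = (\<Sum>u\<in>high. if u \<in> outer_nbrs v then c u else 0)
      + (\<Sum>u\<in>low. (if u \<in> outer_nbrs v \<and> v \<in> lonely \<and> d u = 3 then 3 / 16 else 0)
      - (if u \<in> outer_nbrs v \<and> d v = 3 \<and> u \<in> lonely then 3 / 16 else 0))" for v
  proof -
    have "outer_nbrs v \<subseteq> T" using N_T by (auto simp: outer_nbrs_def)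
    then have "T \<inter> outer_nbrs v = outer_nbrs v" by auto
    then have "(\<Sum>u\<in>outer_nbrs v. flow u v) = (\<Sum>u\<in>T. if u \<in> outer_nbrs v then flow u v else 0)"
      using sum.inter_restrict[OF finite_T, of "\<lambda>u. flow u v" "outer_nbrs v"] by simp
    also have "\<dots> = (\<Sum>u\<in>low. if u \<in> outer_nbrs v then flow u v else 0)
        + (\<Sum>u\<in>high. if u \<in> outer_nbrs v then flow u v else 0)"
      using sum.union_disjoint[OF fin T(2)] unfolding T(1) .
    also have "(\<Sum>u\<in>high. if u \<in> outer_nbrs v then flow u v else 0)
        = (\<Sum>u\<in>high. if u \<in> outer_nbrs v then c u else 0)"
      by (intro sum.cong) (auto simp: flow_def high_def lonely_def)
    also have "(\<Sum>u\<in>low. if u \<in> outer_nbrs v then flow u v else 0)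
      = (\<Sum>u\<in>low. (if u \<in> outer_nbrs v \<and> v \<in> lonely \<and> d u = 3 then 3 / 16 else 0)
      - (if u \<in> outer_nbrs v \<and> d v = 3 \<and> u \<in> lonely then 3 / 16 else 0))"
      using T(2) by (intro sum.cong) (auto simp: flow_def)
    finally show ?thesis by simp
  qed
  have cancel: "(\<Sum>v\<in>low. \<Sum>u\<in>low. if u \<in> outer_nbrs v \<and> v \<in> lonely \<and> d u = 3 then 3 / 16 else (0::real))
      = (\<Sum>v\<in>low. \<Sum>u\<in>low. if u \<in> outer_nbrs v \<and> d v = 3 \<and> u \<in> lonely then 3 / 16 else 0)"
    by (subst sum.swap) (intro sum.cong refl if_cong, use outer_nbrs_sym in blast)
  have "(\<Sum>v\<in>low. \<Sum>u\<in>outer_nbrs v. flow u v)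
      = (\<Sum>v\<in>low. \<Sum>u\<in>high. if u \<in> outer_nbrs v then c u else 0)"
    unfolding split sum.distrib sum_subtractf cancel by simp
  also have "\<dots> = (\<Sum>u\<in>high. \<Sum>v\<in>low. if v \<in> outer_nbrs u then c u else 0)"
    by (subst sum.swap) (simp add: outer_nbrs_sym)
  also have "\<dots> = (\<Sum>u\<in>high. c u * card (outer_nbrs u \<inter> low))"
    using fin
    by - (rule sum.cong[OF refl], simp add: sum.inter_restrict[symmetric] Int_commute)
  finally have 1: "(\<Sum>v\<in>low. \<Sum>u\<in>outer_nbrs v. flow u v) = (\<Sum>u\<in>high. c u * card (outer_nbrs u \<inter> low))" .
  have "(\<Sum>t\<in>triangles F. \<Sum>u\<in>t \<inter> high. 2 * c u)
      = (\<Sum>t\<in>triangles F. \<Sum>u\<in>high. if u \<in> t then 2 * c u else 0)"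
    using fin
    by - (rule sum.cong[OF refl], simp add: sum.inter_restrict[symmetric] Int_commute)
  also have "\<dots> = (\<Sum>u\<in>high. \<Sum>t\<in>triangles F. if u \<in> t then 2 * c u else 0)"
    by (rule sum.swap)
  also have "\<dots> = (\<Sum>u\<in>high. c u * (2 * card {t \<in> triangles F. u \<in> t}))"
    using finite_tri by - (rule sum.cong[OF refl], simp add: sum.inter_filter[symmetric])
  finally have 2: "(\<Sum>t\<in>triangles F. \<Sum>u\<in>t \<inter> high. 2 * c u)
    = (\<Sum>u\<in>high. c u * (2 * card {t \<in> triangles F. u \<in> t}))" .
  have "(\<Sum>u\<in>high. c u * card (outer_nbrs u \<inter> low)) + (\<Sum>u\<in>high. c u * (2 * card {t \<in> triangles F. u \<in> t}))
     \<le> (\<Sum>u\<in>high. 2 * real (d u) - 6 + 3 / 4 * \<kappa> u)"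
    unfolding sum.distrib[symmetric]
  proof (rule sum_mono)
    fix u assume u: "u \<in> high"
    have "card (outer_nbrs u \<inter> low) \<le> card (outer_nbrs u)" by (intro card_mono) auto
    then have "real (card (outer_nbrs u \<inter> low)) + 2 * card {t \<in> triangles F. u \<in> t} \<le> d u"
      using card_triangles_at[of u] by linarith
    then have "c u * (real (card (outer_nbrs u \<inter> low)) + 2 * card {t \<in> triangles F. u \<in> t}) \<le> c u * d u"
      using c_half[OF u] by (intro mult_left_mono) auto
    also have "c u * d u = 2 * real (d u) - 6"
    proof -
      have "N u \<noteq> {}" using u by (auto simp: high_def)
      then show ?thesis by (simp add: c_def field_simps)
    qed
    finally show "c u * real (card (outer_nbrs u \<inter> low)) + c u * real (2 * card {t \<in> triangles F. u \<in> t})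
      \<le> 2 * real (d u) - 6 + 3 / 4 * \<kappa> u"
      by (simp add: distrib_left add_increasing2)
  qed
  moreover have "(\<Sum>v\<in>low. \<psi> v) = (\<Sum>v\<in>low. 2 * real (d v) - 6 + 3 / 4 * \<kappa> v)
     + (\<Sum>v\<in>low. \<Sum>u\<in>outer_nbrs v. flow u v)"
    unfolding \<psi>_def by (rule sum.distrib)
  moreover have "(\<Sum>v\<in>T. 2 * real (d v) - 6 + 3 / 4 * \<kappa> v)
     = (\<Sum>v\<in>low. 2 * real (d v) - 6 + 3 / 4 * \<kappa> v) + (\<Sum>v\<in>high. 2 * real (d v) - 6 + 3 / 4 * \<kappa> v)"
    using sum.union_disjoint[OF fin T(2)] unfolding T(1) .
  ultimately show ?thesis using 1 2 by linarith
qed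

text \<open>Without triangles the stuck condition says that the degrees of the neighbours and the
  number of links add up to at least \<open>M + 3\<close>. Whichever of them is large pays the
  deficit \<open>6 - 2 * d v\<close>.\<close>

lemma psi_nonneg:
  assumes "v \<in> low" and no_tri: "\<And>t. t \<in> triangles F \<Longrightarrow> v \<notin> t"
  shows "0 \<le> \<psi> v"
proof -
  have vT: "v \<in> T" and d3: "d v \<le> 3" using assms(1) by (auto simp: low_def)
  have out: "outer_nbrs v = N v" using no_tri by (auto simp: outer_nbrs_def)
  have st: "M + 3 \<le> (\<Sum>u\<in>N v. d u) + \<kappa> v" using stuck[OF vT d3] by simp
  have uM: "d u \<le> M" if "u \<in> N v" for u using deg_le N_T[OF that] by auto
  have uhigh: "u \<in> high \<longleftrightarrow> 4 \<le> d u" if "u \<in> N v" for u using N_T[OF that] by (auto simp: high_def)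
  have \<psi>: "\<psi> v = 2 * real (d v) - 6 + 3 / 4 * \<kappa> v + (\<Sum>u\<in>N v. flow u v)"
    by (simp add: \<psi>_def out)
  consider "d v = 0" | "d v = 1" | "d v = 2" | "d v = 3" using d3 by linarith
  then show ?thesis
  proof cases
    case 1
    then have "N v = {}" by simp
    then show ?thesis using st M \<psi> by simp
  next
    case 2
    then obtain u where u: "N v = {u}" by (auto simp: card_1_singleton_iff)
    have st': "M + 3 \<le> d u + \<kappa> v" using st u by simp
    have fl: "flow u v \<ge> 0" using flow_ge(3)[of v u] 2 by simp
    show ?thesis
    proof (cases "6 \<le> \<kappa> v")
      case True
      then show ?thesis using \<psi> u fl by simp
    next
      case False
      \<comment> \<open>\<open>\<kappa> v \<le> 5\<close> gives the first bound and
        \<open>d u \<le> M\<close> the second; the balance - 4 + 9 / 4 + 9 / 5 is just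
        positive.\<close>
      then have "30 \<le> d u" "3 \<le> \<kappa> v" using st' M uM[of u] u by simp_all
      moreover from this have "flow u v \<ge> 2 - 6 / 30"
        using order_trans[OF c_ge[of u 30] flow_ge(1)[of u v]] uhigh[of u] u by simp
      ultimately show ?thesis using \<psi> u by simp
    qed
  next
    case 3
    then obtain u w where uw: "N v = {u, w}" "u \<noteq> w" by (auto simp: card_2_iff)
    have lonely: "v \<in> lonely" using 3 vT no_tri by (auto simp: lonely_def)
    have main: "0 \<le> \<psi> v" if uw: "N v = {u, w}" "u \<noteq> w" and le: "d w \<le> d u" for u w
    proof -
      have st': "M + 3 \<le> d u + d w + \<kappa> v" using st uw by simp
      have fl: "flow u v \<ge> 0" "flow w v \<ge> 0" using flow_ge(3)[of v] 3 by simp_all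
      have \<psi>': "\<psi> v = - 2 + 3 / 4 * \<kappa> v + (flow u v + flow w v)" using \<psi> 3 uw by simp
      show ?thesis
      proof (cases "3 \<le> \<kappa> v")
        case True
        then show ?thesis using \<psi>' fl by simp
      next
        case k2: False
        \<comment> \<open>The larger of two degrees with sum at least 32 + 3 - 2 = 33.\<close>
        then have u17: "17 \<le> d u" using st' M le by simp
        have fu: "flow u v \<ge> 2 - 6 / n" if "4 \<le> n" "n \<le> d u" for n :: nat
          using order_trans[OF c_ge[of u n] flow_ge(1)[of u v]] uhigh[of u] uw that by simp
        consider "4 \<le> d w" | "1 \<le> \<kappa> v" | "\<kappa> v = 0" "d w \<le> 3" by linarith
        then show ?thesis
        proof cases
          case 1
          then have "flow w v \<ge> 1 / 2"
            using order_trans[OF c_half[of w] flow_ge(1)[of w v]] uhigh[of w] uw by simp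
          then show ?thesis using \<psi>' fu[of 17] u17 by simp
        next
          case 2
          then show ?thesis using \<psi>' fu[of 17] u17 fl by simp
        next
          case 3
          \<comment> \<open>Without links only this extreme case is left; at \<open>M = 32\<close>
            the balance - 2 + (2 - 6 / 32) + 3 / 16 is exactly 0.\<close>
          then have "d w = 3" "d u = M" using st' uM[of u] uw by simp_all
          then have "flow w v \<ge> 3 / 16" "flow u v \<ge> 2 - 6 / 32"
            using flow_ge(5)[OF lonely, of w] fu[of 32] M by simp_all
          then show ?thesis using \<psi>' by simp
        qed
      qed
    qed
    have "N v = {w, u}" using uw(1) by auto
    then show ?thesis using main[OF uw] main[of w u] uw(2) by (cases "d w \<le> d u") auto
  next
    case 4
    have fl: "flow u v \<ge> - 3 / 16" for u using flow_ge(2) .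
    have "(\<Sum>u\<in>N v. flow u v) \<ge> (\<Sum>u\<in>N v. - 3 / 16)" using fl by (rule sum_mono)
    then have s: "(\<Sum>u\<in>N v. flow u v) \<ge> - 9 / 16" using 4 by simp
    \<comment> \<open>One link, worth \<open>3 / 4\<close>, covers three payments of
      \<open>3 / 16\<close>. Without links some neighbour is high; it gives at least
      \<open>1 / 2\<close> and receives nothing, which covers the other two payments.\<close>
    show ?thesis
    proof (cases "\<kappa> v = 0")
      case False
      then show ?thesis using \<psi> s 4 by simp
    next
      case True
      have "\<exists>u\<in>N v. 4 \<le> d u"
      proof (rule ccontr)
        assume "\<not> ?thesis"
        then have "(\<Sum>u\<in>N v. d u) \<le> (\<Sum>u\<in>N v. 3)" by (intro sum_mono) auto
        then show False using st True M 4 by simp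
      qed
      then obtain u where u: "u \<in> N v" "4 \<le> d u" by auto
      then have "flow u v \<ge> 1 / 2"
        using order_trans[OF c_half[of u] flow_ge(1)[of u v]] uhigh[of u] by simp
      moreover have "(\<Sum>w\<in>N v - {u}. flow w v) \<ge> (\<Sum>w\<in>N v - {u}. - 3 / 16)" using fl by (rule sum_mono)
      then have "(\<Sum>w\<in>N v - {u}. flow w v) \<ge> - 3 / 8" using 4 u(1) by simp
      moreover have "(\<Sum>w\<in>N v. flow w v) = flow u v + (\<Sum>w\<in>N v - {u}. flow w v)"
        using u(1) by (intro sum.remove) auto
      ultimately show ?thesis using \<psi> 4 True by simp
    qed
  qed
qed

text \<open>For degree 3, let \<open>x\<close> be the third neighbour; then
  \<open>d x + \<kappa> v\<close> is at least \<open>M + 5 - Y\<close>. If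
  \<open>Y \<le> M + 2\<close> this is at least 3, so either \<open>x\<close> has not degree 2 and
  is owed nothing, or there is a link, whose \<open>3 / 4\<close> exceeds \<open>3 / 16\<close>. If
  \<open>Y + 7 \<le> M\<close> it is at least 12, which yields 2 - 6 / 12 = 3 / 2 from a large
  \<open>x\<close>, or as much with the help of links.\<close>

lemma triangle_share_vertex:
  assumes t: "{v, y, z} \<in> triangles F" "v \<noteq> y" "v \<noteq> z" "y \<noteq> z"
  shows "triangle_share M (d y + d z) (d v) (if v \<in> high then 2 * c v else \<psi> v)"
proof -
  have vyz: "v \<in> N y" "y \<in> N v" "v \<in> N z" "z \<in> N v" "y \<in> N z" "z \<in> N y"
    using triangle_nbrs[OF t(1)] t by auto
  have vT: "v \<in> T" using N_T vyz(1) by auto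
  have two: "2 \<le> d v" using card_mono[of "N v" "{y, z}"] vyz t(4) by simp
  have dM: "d v \<le> M" using deg_le[OF vT] .
  have tri1: "1 \<le> card {t \<in> triangles F. v \<in> t}"
    using t(1) finite_tri by (auto simp: Suc_le_eq card_gt_0_iff)
  show ?thesis
  proof (cases "4 \<le> d v")
    case True
    then have "v \<in> high" using vT by (simp add: high_def)
    then show ?thesis using True dM by (auto simp: triangle_share_def c_def)
  next
    case False
    then have d3: "d v \<le> 3" and nh: "v \<notin> high" by (auto simp: high_def)
    have yz: "{y, z} \<subseteq> N v" using vyz by auto
    \<comment> \<open>Two more than in the stuck condition: each of \<open>y\<close> and
      \<open>z\<close> has the other as a common neighbour with \<open>v\<close>.\<close>
    have st: "M + 5 \<le> (\<Sum>u\<in>N v. d u) + \<kappa> v"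
    proof -
      have "(\<Sum>u\<in>{y, z}. 1) \<le> (\<Sum>u\<in>{y, z}. card (N u \<inter> N v))"
      proof (rule sum_mono)
        fix u assume "u \<in> {y, z}"
        then have "N u \<inter> N v \<noteq> {}" using vyz by auto
        then show "1 \<le> card (N u \<inter> N v)" by (simp add: Suc_le_eq card_gt_0_iff)
      qed
      also have "\<dots> \<le> (\<Sum>u\<in>N v. card (N u \<inter> N v))" using yz by (intro sum_mono2) auto
      finally show ?thesis using stuck[OF vT d3] t(4) by simp
    qed
    have "d v = 2 \<or> d v = 3" using two d3 by linarith
    then show ?thesis
    proof
      assume d2: "d v = 2"
      then have "N v = {y, z}" using card_subset_eq[OF finite_N yz] t(4) by simp
      then have "M + 5 \<le> d y + d z + \<kappa> v" using st t(4) by simp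
      moreover have "card (outer_nbrs v) = 0" using card_triangles_at[of v] d2 tri1 by linarith
      then have "outer_nbrs v = {}" by simp
      then have "\<psi> v = - 2 + 3 / 4 * \<kappa> v" using d2 by (simp add: \<psi>_def)
      ultimately show ?thesis using d2 dM nh unfolding triangle_share_def by auto
    next
      assume d3: "d v = 3"
      then have "card (N v - {y, z}) = 1" using yz t(4) by (simp add: card_Diff_subset)
      then obtain x where x: "N v - {y, z} = {x}" by (auto simp: card_1_singleton_iff)
      then have Nv: "N v = {y, z, x}" and xyz: "x \<noteq> y" "x \<noteq> z" using yz by auto
      then have st': "M + 5 \<le> d y + d z + d x + \<kappa> v" using st t(4) by simp
      have o1: "card (outer_nbrs v) = 1" using card_triangles_at[of v] d3 tri1 by presburger
      moreover have "outer_nbrs v \<subseteq> {x}" using Nv t(1) by (auto simp: outer_nbrs_def)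
      ultimately have "outer_nbrs v = {x}" by (auto simp: card_1_singleton_iff)
      then have \<psi>: "\<psi> v = 3 / 4 * \<kappa> v + flow x v" using d3 by (simp add: \<psi>_def)
      have fl: "flow x v \<ge> - 3 / 16" using flow_ge(2) .
      have xT: "x \<in> T" using N_T[of x v] Nv by auto
      have fx: "flow x v \<ge> 2 - 6 / n" if "4 \<le> n" "n \<le> d x" for n :: nat
        using order_trans[OF c_ge[of x n] flow_ge(1)[of x v]] xT that by (simp add: high_def)
      have "\<psi> v \<ge> 0" if "d y + d z \<le> M + 2"
      proof (cases "d x = 2")
        case True
        then have "1 \<le> \<kappa> v" using st' that by simp
        then show ?thesis using \<psi> fl by simp
      next
        case False
        then show ?thesis using \<psi> flow_ge(4)[of x v] by simp
      qed
      moreover have "\<psi> v \<ge> 3 / 2" if "d y + d z + 7 \<le> M"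
      proof -
        have h: "12 \<le> d x + \<kappa> v" using st' that by simp
        consider "12 \<le> d x" | "4 \<le> d x" "d x < 12" | "d x \<le> 3" by linarith
        then show ?thesis
        proof cases
          case 1
          then show ?thesis using fx[of 12] \<psi> by simp
        next
          case 2
          show ?thesis
          proof (cases "\<kappa> v \<ge> 2")
            case True
            then show ?thesis using fx[of 4] 2 \<psi> by simp
          next
            case False
            then have "10 \<le> d x" "d x = 11 \<and> \<kappa> v = 1" using h 2 by auto
            then show ?thesis using fx[of 10] \<psi> by simp
          qed
        next
          case 3
          then have "9 \<le> \<kappa> v" using h by simp
          then show ?thesis using fl \<psi> by simp
        qed
      qed
      moreover have "\<psi> v \<ge> - 3 / 16" using \<psi> fl by simp
      ultimately show ?thesis using d3 dM nh unfolding triangle_share_def by auto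
    qed
  qed
qed

lemma triangle_total:
  assumes "t \<in> triangles F"
  shows "3 \<le> (\<Sum>u\<in>t \<inter> high. 2 * c u) + (\<Sum>v\<in>t \<inter> low. \<psi> v)"
proof -
  have "t \<noteq> {}" using triangle_card[OF assms] by auto
  then obtain x where "x \<in> t" by auto
  then obtain y z where t: "t = {x, y, z}" "x \<noteq> y" "x \<noteq> z" "y \<noteq> z"
    using triangle_others[OF assms] by metis
  let ?v = "\<lambda>v. if v \<in> high then 2 * c v else \<psi> v"
  have tT: "t \<subseteq> T" using triangle_T[OF assms] .
  have "triangle_share M (d y + d z) (d x) (?v x)"
    using triangle_share_vertex[of x y z] assms t by auto
  moreover have "triangle_share M (d x + d z) (d y) (?v y)"
    using triangle_share_vertex[of y x z] assms t by (auto simp: insert_commute)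
  moreover have "triangle_share M (d x + d y) (d z) (?v z)"
    using triangle_share_vertex[of z x y] assms t by (auto simp: insert_commute)
  ultimately have "3 \<le> ?v x + ?v y + ?v z" by (rule triangle_share_sum[OF M])
  also have "\<dots> = (\<Sum>v\<in>t. ?v v)" using t by simp
  also have "\<dots> = (\<Sum>v\<in>t \<inter> {v. v \<in> high}. 2 * c v) + (\<Sum>v\<in>t \<inter> - {v. v \<in> high}. \<psi> v)"
    using finite_triangle[OF assms] by (rule sum.If_cases)
  also have "t \<inter> - {v. v \<in> high} = t \<inter> low" using tT by (auto simp: high_def low_def)
  finally show ?thesis by simp
qed

text \<open>Two triangles at a vertex need degree 4, so a low vertex lies in at most one, and its
  final charge can be assigned to that triangle. Low vertices in no triangle have nonnegative
  charge.\<close>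

lemma discharging:
  "6 * real (card T) + 3 * card (triangles F) \<le> 4 * card F + 3 / 4 * (\<Sum>v\<in>T. \<kappa> v)"
proof -
  have fin: "finite low" using finite_T by (auto simp: low_def)
  have "(\<Sum>v\<in>low. \<psi> v) = (\<Sum>v\<in>low \<inter> \<Union>(triangles F). \<psi> v) + (\<Sum>v\<in>low - \<Union>(triangles F). \<psi> v)"
    using fin by (simp add: sum.Int_Diff)
  moreover have "0 \<le> (\<Sum>v\<in>low - \<Union>(triangles F). \<psi> v)"
    using psi_nonneg by (intro sum_nonneg) auto
  moreover have "(\<Sum>v\<in>low \<inter> \<Union>(triangles F). \<psi> v) = (\<Sum>t\<in>triangles F. \<Sum>v\<in>t \<inter> low. \<psi> v)"
  proof -
    have "t = t'" if "t \<in> triangles F" "t' \<in> triangles F" "v \<in> t" "v \<in> t'" "v \<in> low" for t t' v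
    proof (rule ccontr)
      assume "t \<noteq> t'"
      then have "2 \<le> card {t, t'}" by simp
      also have "\<dots> \<le> card {t \<in> triangles F. v \<in> t}"
        using that finite_tri by (intro card_mono) auto
      finally have "4 \<le> d v" using card_triangles_at[of v] by simp
      then show False using that(5) by (simp add: low_def)
    qed
    then have "(\<Sum>v\<in>(\<Union>t\<in>triangles F. t \<inter> low). \<psi> v) = (\<Sum>t\<in>triangles F. \<Sum>v\<in>t \<inter> low. \<psi> v)"
      using finite_tri finite_triangle by (intro sum.UNION_disjoint) auto
    moreover have "low \<inter> \<Union>(triangles F) = (\<Union>t\<in>triangles F. t \<inter> low)" by auto
    ultimately show ?thesis by simp
  qed
  moreover have "3 * real (card (triangles F))
      \<le> (\<Sum>t\<in>triangles F. (\<Sum>u\<in>t \<inter> high. 2 * c u) + (\<Sum>v\<in>t \<inter> low. \<psi> v))"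
    using sum_bounded_below[of "triangles F" 3 "\<lambda>t. (\<Sum>u\<in>t \<inter> high. 2 * c u) + (\<Sum>v\<in>t \<inter> low. \<psi> v)"]
      triangle_total by (simp add: mult.commute)
  ultimately have "3 * real (card (triangles F)) \<le> (\<Sum>v\<in>T. 2 * real (d v) - 6 + 3 / 4 * \<kappa> v)"
    using total by (simp add: sum.distrib)
  also have "\<dots> = 2 * real (\<Sum>v\<in>T. d v) - 6 * real (card T) + 3 / 4 * (\<Sum>v\<in>T. \<kappa> v)"
    by (simp add: sum.distrib sum_subtractf sum_distrib_left)
  also have "(\<Sum>v\<in>T. d v) = 2 * card F" using handshake[OF simple] .
  finally show ?thesis by simp
qed

end

section \<open>Greedy labelling\<close>

text \<open>Common neighbours are taken in the whole graph, also outside \<open>T\<close>: removing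
  a vertex must not erase the constraints between those that remain. Adjacent vertices are included,
  as they must differ by \<open>p \<ge> q\<close> anyway.\<close>

definition close_nbrs :: "'a set set \<Rightarrow> 'a set \<Rightarrow> 'a \<Rightarrow> 'a set" where
  "close_nbrs E T v = {w \<in> T. w \<noteq> v \<and> (w \<in> nbrs E v \<or> nbrs E v \<inter> nbrs E w \<noteq> {})}"

text \<open>A vertex \<open>z\<close> outside \<open>T\<close> with \<open>A\<close> as its neighbours in \<open>T\<close> pays \<open>3 / 4\<close> for each ordered pair that
  it brings within distance two.\<close>

lemma linking_vertex_gain:
  assumes "simple_graph V E" "\<not> contains_cycle E 4" "A \<subseteq> nbrs E z" "card A \<le> 3"
    and r: "r = {(v, w). v \<in> A \<and> w \<in> A \<and> v \<noteq> w \<and> w \<notin> nbrs E v}"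
    and ne: "r \<noteq> {}"
  shows "6 + 3 * real (card {e \<in> E. e \<subseteq> A}) + 3 / 4 * card r
    \<le> 4 * real (card A)"
proof -
  have finA: "finite A" using finite_nbrs[OF assms(1)] assms(3) finite_subset by auto
  obtain v w where vw: "(v, w) \<in> r" using ne by auto
  then have vw': "v \<in> A" "w \<in> A" "v \<noteq> w" "w \<notin> nbrs E v" using r by auto
  have sub: "{v, w} \<subseteq> A" using vw' by auto
  have two: "2 \<le> card A" using card_mono[OF finA sub] vw'(3) by simp
  have edge: "\<exists>x y. e = {x, y} \<and> x \<noteq> y \<and> x \<in> A \<and> y \<in> A \<and> x \<in> nbrs E y \<and> y \<in> nbrs E x"
    if e: "e \<in> E" "e \<subseteq> A" for e
  proof -
    have "card e = 2" using assms(1) e by (simp add: simple_graph_def)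
    then obtain x y where "e = {x, y}" "x \<noteq> y" by (auto simp: card_2_iff)
    then show ?thesis using e by (auto simp: nbrs_def insert_commute)
  qed
  \<comment> \<open>Available against ordered pairs: 8 - 6 = 2 for 2 pairs, 12 - 6 = 6 for 6 pairs,
    and with an edge inside \<open>A\<close> 12 - 6 - 3 = 3 for 4 pairs.\<close>
  consider "card A = 2" | "card A = 3" using two assms(4) by linarith
  then show ?thesis
  proof cases
    case 1
    then have Aeq: "A = {v, w}" using card_subset_eq[OF finA sub] vw'(3) by simp
    have "e \<notin> E" if "e \<subseteq> A" for e
      using edge[of e] that vw'(4) nbrs_sym[of v E w] unfolding Aeq by auto
    then have "{e \<in> E. e \<subseteq> A} = {}" by auto
    then have e0: "card {e \<in> E. e \<subseteq> A} = 0" by (simp only: card.empty)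
    have "r \<subseteq> {(v, w), (w, v)}" unfolding r Aeq by auto
    then have "card r \<le> card {(v, w), (w, v)}" by (rule card_mono[rotated]) simp
    also have "\<dots> \<le> 2" using card_length[of "[(v, w), (w, v)]"] by simp
    finally show ?thesis using 1 e0 by simp
  next
    case 2
    then have "card (A - {v, w}) = 1" using sub vw'(3) by (simp add: card_Diff_subset)
    then obtain u where u: "A - {v, w} = {u}" by (auto simp: card_1_singleton_iff)
    then have Aeq: "A = {u, v, w}" and uvw: "u \<noteq> v" "u \<noteq> w" using sub by auto
    have zn: "x \<in> nbrs E z" "x \<noteq> z" if "x \<in> A" for x
      using that assms(3) nbrs_irrefl[OF assms(1)] by auto
    show ?thesis
    proof (cases "u \<in> nbrs E v \<or> u \<in> nbrs E w")
      case False
      then have "e \<notin> E" if "e \<subseteq> A" for e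
        using edge[of e] that vw'(4) nbrs_sym[of _ E] unfolding Aeq by auto
      then have "{e \<in> E. e \<subseteq> A} = {}" by auto
      then have e0: "card {e \<in> E. e \<subseteq> A} = 0" by (simp only: card.empty)
      have "r \<subseteq> {(u, v), (v, u), (u, w), (w, u), (v, w), (w, v)}" unfolding r Aeq by auto
      then have "card r \<le> card {(u, v), (v, u), (u, w), (w, u), (v, w), (w, v)}"
        by (rule card_mono[rotated]) simp
      also have "\<dots> \<le> 6" using card_length[of "[(u, v), (v, u), (u, w), (w, u), (v, w), (w, v)]"] by simp
      finally show ?thesis using 2 e0 by simp
    next
      case True
      have main: ?thesis if Aeq: "A = {x, y, t}" and d: "x \<noteq> y" "x \<noteq> t" "y \<noteq> t" and xy: "x \<in> nbrs E y" for x y t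
      proof -
        \<comment> \<open>A second edge inside \<open>A\<close> would share an end with the first,
          and this end would have two common neighbours with \<open>z\<close>.\<close>
        have n1: "t \<notin> nbrs E x"
        proof
          assume "t \<in> nbrs E x"
          then have "y = t" using common_nbr_unique[OF assms(1,2), of z x y t] zn[of x] zn[of y] zn[of t] Aeq xy nbrs_sym[of x E y]
            by auto
          then show False using d by simp
        qed
        have n2: "t \<notin> nbrs E y"
        proof
          assume "t \<in> nbrs E y"
          then have "x = t" using common_nbr_unique[OF assms(1,2), of z y x t] zn[of x] zn[of y] zn[of t] Aeq xy
            by auto
          then show False using d by simp
        qed
        have "e = {x, y}" if "e \<in> E" "e \<subseteq> A" for e
          using edge[OF that] n1 n2 nbrs_sym[of _ E] unfolding Aeq by auto
        then have "{e \<in> E. e \<subseteq> A} \<subseteq> {{x, y}}" by auto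
        then have "card {e \<in> E. e \<subseteq> A} \<le> card {{x, y}}" by (rule card_mono[rotated]) simp
        then have e1: "card {e \<in> E. e \<subseteq> A} \<le> 1" by simp
        have "r \<subseteq> {(x, t), (t, x), (y, t), (t, y)}"
          unfolding r Aeq using xy nbrs_sym[of x E y] by auto
        then have "card r \<le> card {(x, t), (t, x), (y, t), (t, y)}" by (rule card_mono[rotated]) simp
        also have "\<dots> \<le> 4" using card_length[of "[(x, t), (t, x), (y, t), (t, y)]"] by simp
        finally show ?thesis using 2 e1 by simp
      qed
      have A': "A = {u, v, w}" "A = {u, w, v}" using Aeq by auto
      show ?thesis using True main[OF A'(1)] main[OF A'(2)] uvw vw'(3) by auto
    qed
  qed
qed

text \<open>Through a neighbour \<open>u\<close> in \<open>T\<close>, the vertex \<open>v\<close>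
  reaches the neighbours of \<open>u\<close> except \<open>v\<close> itself and those already
  adjacent to \<open>v\<close>. The subtracted ones sum up to \<open>card (N v)\<close> and cancel
  the neighbours of \<open>v\<close>. What is reached through vertices outside \<open>T\<close> lies
  in \<open>K\<close>.\<close>

lemma close_nbrs_bound:
  assumes "simple_graph V E" "T \<subseteq> V" "v \<in> T"
    and N: "\<And>u. N u = nbrs E u \<inter> T"
    and K: "K = {w \<in> T. w \<noteq> v \<and> w \<notin> nbrs E v \<and> nbrs E v \<inter> nbrs E w - T \<noteq> {}}"
  shows "card (close_nbrs E T v) + (\<Sum>u\<in>N v. card (N u \<inter> N v)) \<le> (\<Sum>u\<in>N v. card (N u)) + card K"
proof -
  have finN: "finite (N u)" for u using finite_nbrs[OF assms(1)] by (simp add: N)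
  have finT: "finite T" using assms(1,2) finite_subset by (auto simp: simple_graph_def)
  have irr: "u \<notin> N u" for u using nbrs_irrefl[OF assms(1)] by (simp add: N)
  have "close_nbrs E T v \<subseteq> N v \<union> (\<Union>u\<in>N v. N u - {v} - N v) \<union> K"
    by (auto simp: close_nbrs_def N K nbrs_sym)
  then have "card (close_nbrs E T v) \<le> card (N v \<union> (\<Union>u\<in>N v. N u - {v} - N v) \<union> K)"
    using finN finT by (intro card_mono) (auto simp: K)
  also have "\<dots> \<le> card (N v) + card (\<Union>u\<in>N v. N u - {v} - N v) + card K"
    by (meson add_le_mono1 card_Un_le le_trans)
  also have "card (\<Union>u\<in>N v. N u - {v} - N v) \<le> (\<Sum>u\<in>N v. card (N u - {v} - N v))"
    using finN by (rule card_UN_le)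
  finally have 1: "card (close_nbrs E T v) \<le> card (N v) + (\<Sum>u\<in>N v. card (N u - {v} - N v)) + card K"
    by simp
  have "card (N u) = card (N u - {v} - N v) + 1 + card (N u \<inter> N v)" if u: "u \<in> N v" for u
  proof -
    have vu: "v \<in> N u" using u assms(3) nbrs_sym[of u E v] by (auto simp: N)
    have "card (N u) = card (N u - N v) + card (N u \<inter> N v)"
      using finN by (metis add.commute card_Int_Diff)
    moreover have "N u - {v} - N v = N u - N v - {v}" by auto
    then have "card (N u - N v) = Suc (card (N u - {v} - N v))"
      using vu irr[of v] finN by (metis Diff_iff card_Suc_Diff1 finite_Diff)
    ultimately show ?thesis by simp
  qed
  then have "(\<Sum>u\<in>N v. card (N u)) = (\<Sum>u\<in>N v. card (N u - {v} - N v) + 1 + card (N u \<inter> N v))"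
    by (intro sum.cong) auto
  then show ?thesis using 1 by (simp add: sum.distrib sum_Suc)
qed

text \<open>Otherwise \<open>T\<close> is a stuck graph. The edge bound is applied to
  \<open>T\<close> with the linking vertices \<open>S\<close>, but without edges inside
  \<open>S\<close>: then each \<open>z\<close> in \<open>S\<close> adds exactly
  \<open>card (A z)\<close> edges, and triangles only over the edges inside \<open>A z\<close>, so
  that its effect can be computed by itself. The constant 6 of the edge bound is the contradiction
  to \<open>discharging\<close>.\<close>

lemma exists_easy_vertex:
  assumes simple: "simple_graph V E" and planar: "planar V E"
    and C4: "\<not> contains_cycle E 4" and C5: "\<not> contains_cycle E 5"
    and deg: "\<And>v. v \<in> V \<Longrightarrow> card (nbrs E v) \<le> M" and M: "32 \<le> M"
    and T: "T \<subseteq> V" "T \<noteq> {}" and outer: "\<And>v. v \<in> V - T \<Longrightarrow> card (nbrs E v \<inter> T) \<le> 3"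
  shows "\<exists>v\<in>T. card (nbrs E v \<inter> T) \<le> 3 \<and> card (close_nbrs E T v) \<le> M + 2"
proof (rule ccontr)
  assume "\<not> ?thesis"
  then have stuck: "M + 3 \<le> card (close_nbrs E T v)" if "v \<in> T" "card (nbrs E v \<inter> T) \<le> 3" for v
    using that by force
  have finV: "finite V" using simple by (simp add: simple_graph_def)
  then have finT: "finite T" using T finite_subset by auto
  define F where "F = {e \<in> E. e \<subseteq> T}"
  have nbrsF: "nbrs F v = nbrs E v \<inter> T" if "v \<in> T" for v
    using that by (auto simp: nbrs_def F_def)
  have simpleF: "simple_graph T F"
    by (rule simple_graph_subgraph[OF simple T(1)]) (auto simp: F_def)
  define K where "K v = {w \<in> T. w \<noteq> v \<and> w \<notin> nbrs E v \<and> nbrs E v \<inter> nbrs E w - T \<noteq> {}}" for v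
  interpret D: stuck_graph T F "\<lambda>v. card (K v)" M
  proof
    show "simple_graph T F" by (rule simpleF)
    show "\<not> contains_cycle F 4" using C4 contains_cycle_mono[of F 4 E] by (auto simp: F_def)
    show "32 \<le> M" by (rule M)
    fix v assume v: "v \<in> T"
    have "card (nbrs E v \<inter> T) \<le> card (nbrs E v)"
      using finite_nbrs[OF simple] by (intro card_mono) auto
    then show "card (nbrs F v) \<le> M" using deg[of v] v T(1) nbrsF[OF v] by auto
    assume "card (nbrs F v) \<le> 3"
    then have "M + 3 \<le> card (close_nbrs E T v)" using stuck[OF v] nbrsF[OF v] by simp
    moreover have "card (close_nbrs E T v) + (\<Sum>u\<in>nbrs E v \<inter> T. card ((nbrs E u \<inter> T) \<inter> (nbrs E v \<inter> T)))
        \<le> (\<Sum>u\<in>nbrs E v \<inter> T. card (nbrs E u \<inter> T)) + card (K v)"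
      by (rule close_nbrs_bound[OF simple T(1) v refl K_def])
    moreover have "(\<Sum>u\<in>nbrs F v. card (nbrs F u \<inter> nbrs F v))
        = (\<Sum>u\<in>nbrs E v \<inter> T. card ((nbrs E u \<inter> T) \<inter> (nbrs E v \<inter> T)))"
      using nbrsF v by (intro sum.cong) auto
    moreover have "(\<Sum>u\<in>nbrs F v. card (nbrs F u)) = (\<Sum>u\<in>nbrs E v \<inter> T. card (nbrs E u \<inter> T))"
      using nbrsF v by (intro sum.cong) auto
    ultimately show "M + 3 + (\<Sum>u\<in>nbrs F v. card (nbrs F u \<inter> nbrs F v))
        \<le> (\<Sum>u\<in>nbrs F v. card (nbrs F u)) + card (K v)" by linarith
  qed
  define A where "A z = nbrs E z \<inter> T" for z
  define r where "r z = {(v, w). v \<in> A z \<and> w \<in> A z \<and> v \<noteq> w \<and> w \<notin> nbrs E v}" for z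
  \<comment> \<open>Outside vertices that link no pair stay out: they would cost 6 and need not
    bring enough edges in return.\<close>
  define S where "S = {z \<in> V - T. r z \<noteq> {}}"
  define Q where "Q z = {e \<in> E. e \<subseteq> A z}" for z
  have finS: "finite S" using finV by (simp add: S_def)
  have finA: "finite (A z)" for z using finT by (simp add: A_def)
  have finE: "finite E" using simple finite_subset[of E "Pow V"] by (auto simp: simple_graph_def)
  have gain: "6 + 3 * real (card (Q z)) + 3 / 4 * card (r z) \<le> 4 * real (card (A z))" if "z \<in> S" for z
    unfolding Q_def
  proof (rule linking_vertex_gain[OF simple C4])
    show "A z \<subseteq> nbrs E z" "card (A z) \<le> 3" "r z \<noteq> {}"
      using that outer[of z] by (auto simp: S_def A_def)
  qed (rule r_def)
  have kappa: "(\<Sum>v\<in>T. card (K v)) \<le> (\<Sum>z\<in>S. card (r z))"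
  proof -
    have "finite (r z)" for z
      by (rule finite_subset[of _ "A z \<times> A z"]) (use finA in \<open>auto simp: r_def\<close>)
    moreover have "Sigma T K \<subseteq> (\<Union>z\<in>S. r z)"
    proof
      fix x assume "x \<in> Sigma T K"
      then obtain v w where x: "x = (v, w)" "v \<in> T" "w \<in> T" "w \<noteq> v" "w \<notin> nbrs E v"
        "nbrs E v \<inter> nbrs E w - T \<noteq> {}" by (auto simp: K_def)
      then obtain z where z: "z \<in> nbrs E v" "z \<in> nbrs E w" "z \<notin> T" by auto
      then have "(v, w) \<in> r z" using x nbrs_sym[of z E] by (auto simp: r_def A_def)
      moreover have "z \<in> V" using z(1) nbrs_subset[OF simple] by auto
      ultimately show "x \<in> (\<Union>z\<in>S. r z)" using x(1) z(3) by (auto simp: S_def)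
    qed
    ultimately have "card (Sigma T K) \<le> card (\<Union>z\<in>S. r z)" using finS by (intro card_mono) auto
    also have "\<dots> \<le> (\<Sum>z\<in>S. card (r z))" using finS by (rule card_UN_le)
    finally show ?thesis using finT by (simp add: K_def)
  qed
  define E' where "E' = F \<union> (\<Union>z\<in>S. (\<lambda>v. {z, v}) ` A z)"
  have E'E: "E' \<subseteq> E" by (auto simp: E'_def F_def A_def nbrs_def insert_commute)
  have E'V: "e \<subseteq> T \<union> S" if "e \<in> E'" for e using that by (auto simp: E'_def F_def A_def)
  have "4 * card E' + 6 \<le> 6 * card (T \<union> S) + 3 * card (triangles E')"
  proof (rule planar_edge_bound)
    have sub: "T \<union> S \<subseteq> V" using T(1) by (auto simp: S_def)
    show "simple_graph (T \<union> S) E'" by (rule simple_graph_subgraph[OF simple sub E'E E'V])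
    show "planar (T \<union> S) E'" by (rule planar_subgraph[OF planar sub E'E E'V])
    show "\<not> contains_cycle E' 4" "\<not> contains_cycle E' 5"
      using contains_cycle_mono[OF _ E'E] C4 C5 by metis+
    show "T \<union> S \<noteq> {}" using T(2) by auto
  qed
  moreover have "card (T \<union> S) = card T + card S"
    using finT finS by (intro card_Un_disjoint) (auto simp: S_def)
  moreover have "card E' = card F + (\<Sum>z\<in>S. card (A z))"
  proof -
    have ST: "z \<notin> T" if "z \<in> S" for z using that by (auto simp: S_def)
    have AT: "A z \<subseteq> T" for z by (auto simp: A_def)
    have "card (\<Union>z\<in>S. (\<lambda>v. {z, v}) ` A z) = (\<Sum>z\<in>S. card ((\<lambda>v. {z, v}) ` A z))"
    proof (rule card_UN_disjoint)
      show "\<forall>y\<in>S. \<forall>z\<in>S. y \<noteq> z \<longrightarrow> (\<lambda>v. {y, v}) ` A y \<inter> (\<lambda>v. {z, v}) ` A z = {}"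
        using ST AT by (fastforce simp: doubleton_eq_iff)
    qed (use finS finA in auto)
    also have "\<dots> = (\<Sum>z\<in>S. card (A z))"
      by (intro sum.cong refl card_image) (auto simp: inj_on_def doubleton_eq_iff)
    finally have 1: "card (\<Union>z\<in>S. (\<lambda>v. {z, v}) ` A z) = (\<Sum>z\<in>S. card (A z))" .
    have 2: "F \<inter> (\<Union>z\<in>S. (\<lambda>v. {z, v}) ` A z) = {}" using ST by (auto simp: F_def)
    show ?thesis unfolding E'_def 1[symmetric]
      using 2 finE finS finA by (intro card_Un_disjoint) (auto simp: F_def)
  qed
  moreover have "card (triangles E') \<le> card (triangles F) + (\<Sum>z\<in>S. card (Q z))"
  proof -
    have finQ: "finite (Q z)" for z using finE by (simp add: Q_def)
    have "triangles E' \<subseteq> triangles F \<union> (\<Union>z\<in>S. insert z ` Q z)"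
    proof
      fix t assume t: "t \<in> triangles E'"
      show "t \<in> triangles F \<union> (\<Union>z\<in>S. insert z ` Q z)"
      proof (cases "t \<subseteq> T")
        case True
        have "e \<in> F" if "e \<subseteq> t" "card e = 2" for e
          using t that True E'E unfolding triangles_def F_def by blast
        then show ?thesis using t by (auto simp: triangles_def)
      next
        case False
        then obtain z where z: "z \<in> t" "z \<notin> T" by auto
        have nA: "y \<in> A z \<and> z \<in> S" if "y \<in> t" "y \<noteq> z" for y
        proof -
          have "{z, y} \<in> E'" using triangle_nbrs[OF t z(1) that(1)] that(2) by (auto simp: nbrs_def)
          then show ?thesis using z(2) by (auto simp: E'_def F_def A_def doubleton_eq_iff S_def)
        qed
        have c: "card (t - {z}) = 2" using t z(1) by (simp add: triangles_def)
        then have "t - {z} \<in> E'" using t unfolding triangles_def by blast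
        then have "t - {z} \<in> Q z" using E'E nA by (auto simp: Q_def)
        moreover have "t - {z} \<noteq> {}" using c by (metis card.empty zero_neq_numeral)
        then have "z \<in> S" using nA by auto
        moreover have "t = insert z (t - {z})" using z(1) by auto
        ultimately show ?thesis by blast
      qed
    qed
    then have "card (triangles E') \<le> card (triangles F \<union> (\<Union>z\<in>S. insert z ` Q z))"
      using D.finite_tri finS finQ by (intro card_mono) auto
    also have "\<dots> \<le> card (triangles F) + card (\<Union>z\<in>S. insert z ` Q z)" by (rule card_Un_le)
    also have "card (\<Union>z\<in>S. insert z ` Q z) \<le> (\<Sum>z\<in>S. card (insert z ` Q z))"
      using finS by (rule card_UN_le)
    also have "\<dots> \<le> (\<Sum>z\<in>S. card (Q z))" by (intro sum_mono card_image_le finQ)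
    finally show ?thesis by simp
  qed
  moreover have "6 * real (card S) + 3 * (\<Sum>z\<in>S. real (card (Q z))) + 3 / 4 * (\<Sum>z\<in>S. real (card (r z)))
      \<le> 4 * (\<Sum>z\<in>S. real (card (A z)))"
    using sum_mono[of S "\<lambda>z. 6 + 3 * real (card (Q z)) + 3 / 4 * card (r z)" "\<lambda>z. 4 * real (card (A z))"] gain
    by (simp add: sum.distrib sum_distrib_left)
  ultimately have "4 * real (card F) + 3 / 4 * (\<Sum>z\<in>S. card (r z)) + 6
      \<le> 6 * real (card T) + 3 * real (card (triangles F))"
    unfolding of_nat_sum[symmetric] by linarith
  then show False using D.discharging kappa by linarith
qed

section \<open>Forbidden labels and the greedy choice\<close>

lemma card_near: "0 < p \<Longrightarrow> card {x::nat. \<bar>int x - int a\<bar> < int p} \<le> 2 * p - 1"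
proof -
  assume "0 < p"
  \<comment> \<open>If \<open>p > a\<close> the subtraction truncates to 0, where the labels start
    anyway, and the interval only becomes shorter.\<close>
  then have "{x::nat. \<bar>int x - int a\<bar> < int p} \<subseteq> {Suc a - p..a + p - 1}" by auto
  then have "card {x::nat. \<bar>int x - int a\<bar> < int p} \<le> card {Suc a - p..a + p - 1}"
    by (intro card_mono) auto
  then show ?thesis by simp
qed

lemma finite_near: "finite {x::nat. \<bar>int x - int a\<bar> < int p}"
  by (rule finite_subset[of _ "{..a + p}"]) auto

text \<open>A neighbour forbids at least as many labels as another close vertex, so the worst case
  is \<open>a = 3\<close> and \<open>b = M - 1\<close>, for which \<open>K\<close> is exactly the
  number of forbidden labels.\<close>

lemma greedy_count:
  assumes "0 < q" "q \<le> p" "a \<le> 3" "a + b \<le> M + 2" "32 \<le> (M::nat)"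
    and K: "int K = (2 * int q - 1) * int M + 6 * int p - 2 * int q - 2"
  shows "a * (2 * p - 1) + b * (2 * q - 1) \<le> K"
proof -
  define P Q :: int where "P = 2 * int p - 1" and "Q = 2 * int q - 1"
  have PQ: "0 \<le> Q" "Q \<le> P" using assms(1,2) by (auto simp: P_def Q_def)
  have "int (a * (2 * p - 1) + b * (2 * q - 1)) = int a * P + int b * Q"
    using assms(1,2) by (simp add: P_def Q_def of_nat_diff)
  also have "\<dots> \<le> int a * P + (int M + 2 - int a) * Q"
    using assms(4) PQ by (intro add_left_mono mult_right_mono) auto
  also have "\<dots> = int a * (P - Q) + (int M + 2) * Q" by (simp add: algebra_simps)
  also have "\<dots> \<le> 3 * (P - Q) + (int M + 2) * Q"
    using assms(3) PQ by (intro add_right_mono mult_right_mono) auto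
  also have "\<dots> = int K" unfolding K P_def Q_def by (simp add: algebra_simps)
  finally show ?thesis by linarith
qed

text \<open>The induction removes an easy vertex \<open>v\<close>, labels the rest, and labels
  \<open>v\<close> last. The condition \<open>outer\<close> survives because \<open>v\<close> itself
  has at most three neighbours in \<open>T\<close>; for \<open>T = V\<close> it is vacuous.\<close>

lemma greedy_labeling:
  assumes simple: "simple_graph V E" and planar: "planar V E"
    and C4: "\<not> contains_cycle E 4" and C5: "\<not> contains_cycle E 5"
    and deg: "\<And>v. v \<in> V \<Longrightarrow> card (nbrs E v) \<le> M" and M: "32 \<le> M"
    and pq: "0 < q" "q \<le> p"
    and K: "int K = (2 * int q - 1) * int M + 6 * int p - 2 * int q - 2"
    and T: "T \<subseteq> V" and outer: "\<And>v. v \<in> V - T \<Longrightarrow> card (nbrs E v \<inter> T) \<le> 3"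
  shows "\<exists>f::'a \<Rightarrow> nat. (\<forall>v\<in>T. f v \<le> K) \<and>
    (\<forall>u\<in>T. \<forall>v\<in>T. (u \<in> nbrs E v \<longrightarrow> int p \<le> \<bar>int (f u) - int (f v)\<bar>) \<and>
      (u \<in> close_nbrs E T v \<longrightarrow> int q \<le> \<bar>int (f u) - int (f v)\<bar>))"
  using T outer
proof (induction "card T" arbitrary: T)
  case 0
  have "finite T" using simple 0(2) finite_subset unfolding simple_graph_def by blast
  then have "T = {}" using 0(1) by simp
  then show ?case by simp
next
  case (Suc n)
  have finT: "finite T" using simple Suc.prems(1) finite_subset by (auto simp: simple_graph_def)
  have "T \<noteq> {}" using Suc.hyps(2) by auto
  then obtain v where v: "v \<in> T" "card (nbrs E v \<inter> T) \<le> 3" "card (close_nbrs E T v) \<le> M + 2"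
    using exists_easy_vertex[OF simple planar C4 C5 deg M Suc.prems(1) _ Suc.prems(2)] by blast
  define T' where "T' = T - {v}"
  have "n = card T'" using Suc.hyps(2) v(1) finT by (simp add: T'_def)
  moreover have "T' \<subseteq> V" using Suc.prems(1) by (auto simp: T'_def)
  moreover have "card (nbrs E u \<inter> T') \<le> 3" if "u \<in> V - T'" for u
  proof -
    have "card (nbrs E u \<inter> T') \<le> card (nbrs E u \<inter> T)"
      using finT by (intro card_mono) (auto simp: T'_def)
    moreover have "card (nbrs E u \<inter> T) \<le> 3"
      using that v Suc.prems(2)[of u] by (cases "u = v") (auto simp: T'_def)
    ultimately show ?thesis by simp
  qed
  ultimately obtain f :: "'a \<Rightarrow> nat" where f: "\<And>u. u \<in> T' \<Longrightarrow> f u \<le> K"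
    "\<And>u w. u \<in> T' \<Longrightarrow> w \<in> T' \<Longrightarrow> u \<in> nbrs E w \<Longrightarrow> int p \<le> \<bar>int (f u) - int (f w)\<bar>"
    "\<And>u w. u \<in> T' \<Longrightarrow> w \<in> T' \<Longrightarrow> u \<in> close_nbrs E T' w \<Longrightarrow> int q \<le> \<bar>int (f u) - int (f w)\<bar>"
    using Suc.hyps(1)[of T'] by blast
  define A where "A = nbrs E v \<inter> T"
  define B where "B = close_nbrs E T v - A"
  have fin: "finite A" "finite B" using finT by (auto simp: A_def B_def close_nbrs_def)
  have AB: "A \<union> B = close_nbrs E T v" using nbrs_irrefl[OF simple]
    by (auto simp: A_def B_def close_nbrs_def)
  have "card A + card B = card (close_nbrs E T v)"
    using card_Un_disjoint[OF fin] AB by (auto simp: B_def)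
  then have cAB: "card A \<le> 3" "card A + card B \<le> M + 2" using v by (auto simp: A_def)
  define bad where "bad = (\<Union>u\<in>A. {x. \<bar>int x - int (f u)\<bar> < int p}) \<union> (\<Union>u\<in>B. {x. \<bar>int x - int (f u)\<bar> < int q})"
  have "card bad \<le> card (\<Union>u\<in>A. {x. \<bar>int x - int (f u)\<bar> < int p}) + card (\<Union>u\<in>B. {x. \<bar>int x - int (f u)\<bar> < int q})"
    unfolding bad_def by (rule card_Un_le)
  also have "\<dots> \<le> (\<Sum>u\<in>A. card {x. \<bar>int x - int (f u)\<bar> < int p}) + (\<Sum>u\<in>B. card {x. \<bar>int x - int (f u)\<bar> < int q})"
    using fin by (intro add_mono card_UN_le)
  also have "\<dots> \<le> (\<Sum>u\<in>A. 2 * p - 1) + (\<Sum>u\<in>B. 2 * q - 1)"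
    using pq by (intro add_mono sum_mono card_near) auto
  also have "\<dots> = card A * (2 * p - 1) + card B * (2 * q - 1)" by simp
  also have "\<dots> \<le> K" using greedy_count[OF pq cAB M K] .
  finally have "card bad < card {..K}" by simp
  moreover have "finite bad" using fin finite_near by (auto simp: bad_def)
  ultimately have "\<not> {..K} \<subseteq> bad" using card_mono by (metis not_le)
  then obtain x where x: "x \<le> K" "x \<notin> bad" by auto
  have xA: "int p \<le> \<bar>int x - int (f u)\<bar>" if "u \<in> A" for u
    using x(2) that by (force simp: bad_def)
  have xB: "int q \<le> \<bar>int x - int (f u)\<bar>" if "u \<in> close_nbrs E T v" for u
  proof (cases "u \<in> A")
    case True
    then show ?thesis using xA[OF True] pq by simp
  next
    case False
    then have "u \<in> B" using that by (simp add: B_def)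
    then show ?thesis using x(2) by (force simp: bad_def)
  qed
  have close_sym: "u \<in> close_nbrs E T w \<longleftrightarrow> w \<in> close_nbrs E T u" if "u \<in> T" "w \<in> T" for u w
    using that nbrs_sym[of u E w] by (auto simp: close_nbrs_def)
  let ?f = "f(v := x)"
  have "int p \<le> \<bar>int (?f u) - int (?f w)\<bar>" if "u \<in> T" "w \<in> T" "u \<in> nbrs E w" for u w
  proof -
    have "u \<noteq> w" using that(3) nbrs_irrefl[OF simple] by auto
    consider "u = v" | "w = v" | "u \<noteq> v" "w \<noteq> v" by blast
    then show ?thesis
    proof cases
      case 1
      then show ?thesis using xA[of w] that \<open>u \<noteq> w\<close> nbrs_sym[of u E w] by (simp add: A_def)
    next
      case 2
      then show ?thesis using xA[of u] that \<open>u \<noteq> w\<close> by (simp add: A_def abs_minus_commute)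
    next
      case 3
      then show ?thesis using f(2)[of u w] that by (simp add: T'_def)
    qed
  qed
  moreover have "int q \<le> \<bar>int (?f u) - int (?f w)\<bar>" if "u \<in> T" "w \<in> T" "u \<in> close_nbrs E T w" for u w
  proof -
    have "u \<noteq> w" using that(3) by (auto simp: close_nbrs_def)
    consider "u = v" | "w = v" | "u \<noteq> v" "w \<noteq> v" by blast
    then show ?thesis
    proof cases
      case 1
      then show ?thesis using xB[of w] that \<open>u \<noteq> w\<close> close_sym[of u w] by simp
    next
      case 2
      then show ?thesis using xB[of u] that \<open>u \<noteq> w\<close> by (simp add: abs_minus_commute)
    next
      case 3
      then have "u \<in> close_nbrs E T' w" using that(3) by (auto simp: close_nbrs_def T'_def)
      then show ?thesis using f(3)[of u w] that 3 by (simp add: T'_def)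
    qed
  qed
  moreover have "?f u \<le> K" if "u \<in> T" for u using f(1)[of u] x(1) that by (simp add: T'_def)
  ultimately show ?case by (intro exI[of _ ?f]) blast
qed

section \<open>Distance two and the labeling number\<close>

lemma graph_dist_2:
  assumes "graph_dist V E u v = 2" "u \<in> V"
  shows "u \<noteq> v \<and> nbrs E u \<inter> nbrs E v \<noteq> {}"
proof
  let ?W = "{w. walk V E w \<and> hd w = u \<and> last w = v}"
  \<comment> \<open>The infimum over no walks is \<infinity>, so some walk exists; in a well-order
    the infimum is then attained.\<close>
  have "?W \<noteq> {}"
  proof
    assume W: "?W = {}"
    have "graph_dist V E u v = \<infinity>" unfolding graph_dist_def W by (simp add: top_enat_def)
    then show False using assms(1) by simp
  qed
  then have "(INF w\<in>?W. enat (length w - 1)) \<in> (\<lambda>w. enat (length w - 1)) ` ?W"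
    using wellorder_InfI by (metis (no_types, lifting) ex_in_conv image_eqI)
  then obtain w where w: "walk V E w" "hd w = u" "last w = v" "enat (length w - 1) = 2"
    using assms(1) unfolding graph_dist_def by auto
  then have "length w = 3" by (cases "length w") (auto simp: numeral_eq_enat)
  then obtain x y z where xyz: "w = [x, y, z]" by (auto simp: numeral_3_eq_3 length_Suc_conv)
  then have "{u, y} \<in> E" "{y, v} \<in> E" using w by (auto simp: walk_def)
  then show "nbrs E u \<inter> nbrs E v \<noteq> {}" by (auto simp: nbrs_def insert_commute)
  show "u \<noteq> v"
  proof
    assume "u = v"
    then have "[u] \<in> ?W" using assms(2) by (auto simp: walk_def)
    then have "graph_dist V E u v \<le> enat (length [u] - 1)"
      unfolding graph_dist_def by (intro INF_lower)
    then show False using assms(1) by (simp add: zero_enat_def[symmetric])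
  qed
qed

lemma L_number_le:
  assumes simple: "simple_graph V E" and planar: "planar V E" and M: "32 \<le> max_degree V E"
    and C4: "\<not> contains_cycle E 4" and C5: "\<not> contains_cycle E 5" and ne: "V \<noteq> {}"
    and pq: "0 < q" "q \<le> p"
  shows "int (L_number V E p q) \<le> (2 * int q - 1) * int (max_degree V E) + 6 * int p - 2 * int q - 2"
proof -
  let ?b = "(2 * int q - 1) * int (max_degree V E) + 6 * int p - 2 * int q - 2"
  define K where "K = nat ?b"
  \<comment> \<open>Makes \<open>?b\<close> nonnegative, so that \<open>nat\<close> changes
    nothing.\<close>
  have "(2 * int q - 1) * 32 \<le> (2 * int q - 1) * int (max_degree V E)"
    using M pq by (intro mult_left_mono) auto
  then have K: "int K = ?b" using pq by (simp add: K_def)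
  have finV: "finite V" using simple by (simp add: simple_graph_def)
  have deg: "card (nbrs E v) \<le> max_degree V E" if "v \<in> V" for v
    using that finV card_nbrs[OF simple] by (simp add: max_degree_def)
  obtain f :: "'a \<Rightarrow> nat" where f: "\<And>v. v \<in> V \<Longrightarrow> f v \<le> K"
    "\<And>u v. u \<in> V \<Longrightarrow> v \<in> V \<Longrightarrow> u \<in> nbrs E v \<Longrightarrow> int p \<le> \<bar>int (f u) - int (f v)\<bar>"
    "\<And>u v. u \<in> V \<Longrightarrow> v \<in> V \<Longrightarrow> u \<in> close_nbrs E V v \<Longrightarrow> int q \<le> \<bar>int (f u) - int (f v)\<bar>"
    using greedy_labeling[OF simple planar C4 C5 deg M pq K subset_refl] by blast
  have "L_labeling V E p q f"
    unfolding L_labeling_def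
  proof (intro ballI conjI impI)
    fix u v assume uv: "u \<in> V" "v \<in> V"
    show "int p \<le> \<bar>int (f u) - int (f v)\<bar>" if "{u, v} \<in> E"
      using f(2)[OF uv] that by (simp add: nbrs_def)
    show "int q \<le> \<bar>int (f u) - int (f v)\<bar>" if "graph_dist V E u v = 2"
      using f(3)[OF uv] graph_dist_2[OF that uv(1)] uv by (auto simp: close_nbrs_def)
  qed
  then have "L_number V E p q \<le> Max (f ` V)"
    unfolding L_number_def by (intro Least_le) blast
  also have "\<dots> \<le> K" using finV ne f(1) by simp
  finally show ?thesis using K by simp
qed

theorem corollary2:
  fixes V :: "'a set" and E :: "'a set set"
  assumes "simple_graph V E"
    and "planar V E"
    and "max_degree V E \<ge> 32"
    and "\<not> contains_cycle E 4"
    and "\<not> contains_cycle E 5"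
    and "V \<noteq> {}"
  shows "(\<forall>p q. 0 < p \<and> 0 < q \<and> q \<le> p \<longrightarrow>
            int (L_number V E p q)
              \<le> (2 * int q - 1) * int (max_degree V E) + 6 * int p - 2 * int q - 2)
         \<and> L_number V E 2 1 \<le> max_degree V E + 8"
  using L_number_le[OF assms] L_number_le[OF assms, of 1 2] by simp

end
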